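(* Let $\mathsf{C}$ be a locally small category. Let $D:\mathsf{J}\to\mathsf{C}$ be a small diagram, and let $X$ be an object of $\mathsf{C}$. The following conditions are equivalent. (1) $X$ is an absolute colimit of $D$ (i.e. $\mathrm{Im}\,D\cong\mathrm{Hom}_{\mathsf{C}}(-,X)$ naturally). (2) For every locally small category $\mathsf{D}$ and every functor $F:\mathsf{C}\to\mathsf{D}$, the object $F(X)$ is the colimit in $\mathsf{D}$ of the composite diagram $F\circ D:\mathsf{J}\to\mathsf{D}$. (3) $D:\mathsf{J}\to\mathsf{C}$ and $X:\mathsf{1}\to\mathsf{C}$ are connected by a zigzag in $\mathsf{Cat}/\mathsf{C}$ such that all the arrows of the underlying zigzag $\mathsf{J}\leftrightsquigarrow\mathsf{1}$ in $\mathsf{Cat}$ are confinal functors.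
   Context: A small diagram in $\mathsf{C}$ is a functor $D:\mathsf{J}\to\mathsf{C}$ with $\mathsf{J}$ a small category. Its image presheaf is the presheaf $\mathrm{Im}\,D=\mathrm{colim}_{J\in\mathsf{J}}\mathrm{Hom}_{\mathsf{C}}(-,DJ)$ on $\mathsf{C}$, i.e. the colimit in $[\mathsf{C}^{\mathrm{op}},\mathsf{Set}]$ of $D$ followed by the Yoneda embedding. In this paper, "$X$ is an absolute colimit of $D$" is by definition the condition that the diagram $D$ and the one-object diagram $X:\mathsf{1}\to\mathsf{C}$ have isomorphic image presheaves, which is the condition in parentheses in (1). A functor $F:\mathsf{A}\to\mathsf{B}$ is confinal if for every object $B$ of $\mathsf{B}$ the comma category $B/F$ is non-empty and connected. $\mathsf{1}$ is the terminal category, and an object $X$ of $\mathsf{C}$ is regarded as a functor $X:\mathsf{1}\to\mathsf{C}$. $\mathsf{Cat}$ is the category of small categories; $\mathsf{Cat}/\mathsf{C}$ has as objects functors $\mathsf{S}\to\mathsf{C}$ with $\mathsf{S}$ small (while $\mathsf{C}$ may be large) and as morphisms strictly commuting triangles over $\mathsf{C}$. A zigzag is a finite sequence of arrows, each pointing in either direction. *)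

theory Defs
  imports Main "HOL-Library.FuncSet"
begin

text \<open>
  Size is handled relative to a type \<open>'v\<close>, playing the role of the class of all sets, and a
  predicate \<open>small\<close> on its subsets. A class is a subset of \<open>'v\<close>, a set is a small one. The
  assumptions hold for the sets of a Grothendieck universe (or of a model of ZFC); power sets and
  infinity are not required, so that they also hold e.g. for the countable subsets of any
  infinite type.
\<close>

locale smallness =
  fixes small :: "'v set \<Rightarrow> bool"
  assumes infinite_universe: "infinite (UNIV :: 'v set)"
    and finite_small: "finite A \<Longrightarrow> small A"
    and subset_small: "small A \<Longrightarrow> B \<subseteq> A \<Longrightarrow> small B"
    and image_small: "small A \<Longrightarrow> small (f ` A)"
    and UNION_small: "small I \<Longrightarrow> (\<And>i. i \<in> I \<Longrightarrow> small (K i)) \<Longrightarrow> small (\<Union>i\<in>I. K i)"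

record ('o, 'a) cat =
  Obj :: "'o set"
  Arr :: "'a set"
  Dom :: "'a \<Rightarrow> 'o"
  Cod :: "'a \<Rightarrow> 'o"
  Ide :: "'o \<Rightarrow> 'a"
  Comp :: "'a \<Rightarrow> 'a \<Rightarrow> 'a"  \<comment> \<open>\<open>Comp C g f\<close> is "g after f"\<close>

definition Hom :: "('o, 'a) cat \<Rightarrow> 'o \<Rightarrow> 'o \<Rightarrow> 'a set" where
  "Hom C x y = {f \<in> Arr C. Dom C f = x \<and> Cod C f = y}"

locale category =
  fixes C :: "('o, 'a) cat"
  assumes Dom_Obj: "f \<in> Arr C \<Longrightarrow> Dom C f \<in> Obj C"
    and Cod_Obj: "f \<in> Arr C \<Longrightarrow> Cod C f \<in> Obj C"
    and Ide_Hom: "x \<in> Obj C \<Longrightarrow> Ide C x \<in> Hom C x x"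
    and Comp_Hom: "f \<in> Hom C x y \<Longrightarrow> g \<in> Hom C y z \<Longrightarrow> Comp C g f \<in> Hom C x z"
    and Comp_Ide_right: "f \<in> Hom C x y \<Longrightarrow> Comp C f (Ide C x) = f"
    and Comp_Ide_left: "f \<in> Hom C x y \<Longrightarrow> Comp C (Ide C y) f = f"
    and Comp_assoc: "f \<in> Hom C w x \<Longrightarrow> g \<in> Hom C x y \<Longrightarrow> h \<in> Hom C y z \<Longrightarrow>
      Comp C h (Comp C g f) = Comp C (Comp C h g) f"

definition locally_small :: "('v set \<Rightarrow> bool) \<Rightarrow> ('o, 'v) cat \<Rightarrow> bool" where
  "locally_small small C \<longleftrightarrow> category C \<and> (\<forall>x\<in>Obj C. \<forall>y\<in>Obj C. small (Hom C x y))"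

definition small_category :: "('v set \<Rightarrow> bool) \<Rightarrow> ('v, 'v) cat \<Rightarrow> bool" where
  "small_category small C \<longleftrightarrow> category C \<and> small (Obj C) \<and> small (Arr C)"

definition opposite :: "('o, 'a) cat \<Rightarrow> ('o, 'a) cat" where
  "opposite C = \<lparr>Obj = Obj C, Arr = Arr C, Dom = Cod C, Cod = Dom C, Ide = Ide C,
     Comp = (\<lambda>g f. Comp C f g)\<rparr>"

definition isomorphic :: "('o, 'a) cat \<Rightarrow> 'o \<Rightarrow> 'o \<Rightarrow> bool" where
  "isomorphic C x y \<longleftrightarrow> (\<exists>f\<in>Hom C x y. \<exists>g\<in>Hom C y x.
     Comp C g f = Ide C x \<and> Comp C f g = Ide C y)"

record ('o, 'a, 'p, 'b) func =
  FObj :: "'o \<Rightarrow> 'p"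
  FArr :: "'a \<Rightarrow> 'b"

definition is_functor :: "('o, 'a) cat \<Rightarrow> ('p, 'b) cat \<Rightarrow> ('o, 'a, 'p, 'b) func \<Rightarrow> bool" where
  "is_functor A B F \<longleftrightarrow>
     (\<forall>x\<in>Obj A. FObj F x \<in> Obj B) \<and>
     (\<forall>f\<in>Arr A. FArr F f \<in> Hom B (FObj F (Dom A f)) (FObj F (Cod A f))) \<and>
     (\<forall>x\<in>Obj A. FArr F (Ide A x) = Ide B (FObj F x)) \<and>
     (\<forall>f\<in>Arr A. \<forall>g\<in>Arr A. Cod A f = Dom A g \<longrightarrow>
        FArr F (Comp A g f) = Comp B (FArr F g) (FArr F f))"

text \<open>Values outside \<open>Obj A\<close> and \<open>Arr A\<close> are irrelevant.\<close>

definition functor_eq ::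
  "('o, 'a) cat \<Rightarrow> ('o, 'a, 'p, 'b) func \<Rightarrow> ('o, 'a, 'p, 'b) func \<Rightarrow> bool" where
  "functor_eq A F G \<longleftrightarrow>
     (\<forall>x\<in>Obj A. FObj F x = FObj G x) \<and> (\<forall>f\<in>Arr A. FArr F f = FArr G f)"

definition functor_comp ::
  "('p, 'b, 'q, 'c) func \<Rightarrow> ('o, 'a, 'p, 'b) func \<Rightarrow> ('o, 'a, 'q, 'c) func" where
  "functor_comp G F = \<lparr>FObj = FObj G \<circ> FObj F, FArr = FArr G \<circ> FArr F\<rparr>"

definition is_nat_trans ::
  "('o, 'a) cat \<Rightarrow> ('p, 'b) cat \<Rightarrow> ('o, 'a, 'p, 'b) func \<Rightarrow> ('o, 'a, 'p, 'b) func \<Rightarrow>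
   ('o \<Rightarrow> 'b) \<Rightarrow> bool" where
  "is_nat_trans A B F G \<eta> \<longleftrightarrow>
     (\<forall>x\<in>Obj A. \<eta> x \<in> Hom B (FObj F x) (FObj G x)) \<and>
     (\<forall>f\<in>Arr A. Comp B (\<eta> (Cod A f)) (FArr F f) = Comp B (FArr G f) (\<eta> (Dom A f)))"

text \<open>
  Functors and transformations are required to be \<^const>\<open>extensional\<close> here, so that each of
  them occurs exactly once.
\<close>

definition functor_category :: "('o, 'a) cat \<Rightarrow> ('p, 'b) cat \<Rightarrow>
  (('o, 'a, 'p, 'b) func,
   ('o, 'a, 'p, 'b) func \<times> ('o, 'a, 'p, 'b) func \<times> ('o \<Rightarrow> 'b)) cat" where
  "functor_category A B =
     (let Fun = {F. is_functor A B F \<and> FObj F \<in> extensional (Obj A)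
                    \<and> FArr F \<in> extensional (Arr A)}
      in \<lparr>Obj = Fun,
          Arr = {(F, G, \<eta>). F \<in> Fun \<and> G \<in> Fun \<and> is_nat_trans A B F G \<eta>
                    \<and> \<eta> \<in> extensional (Obj A)},
          Dom = (\<lambda>(F, G, \<eta>). F),
          Cod = (\<lambda>(F, G, \<eta>). G),
          Ide = (\<lambda>F. (F, F, \<lambda>x\<in>Obj A. Ide B (FObj F x))),
          Comp = (\<lambda>(G, H, \<theta>) (F, G', \<eta>). (F, H, \<lambda>x\<in>Obj A. Comp B (\<theta> x) (\<eta> x)))\<rparr>)"

definition is_cocone :: "('i, 'k) cat \<Rightarrow> ('o, 'a) cat \<Rightarrow> ('i, 'k, 'o, 'a) func \<Rightarrow>
  'o \<Rightarrow> ('i \<Rightarrow> 'a) \<Rightarrow> bool" where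
  "is_cocone J C D x \<iota> \<longleftrightarrow> x \<in> Obj C \<and>
     (\<forall>j\<in>Obj J. \<iota> j \<in> Hom C (FObj D j) x) \<and>
     (\<forall>u\<in>Arr J. Comp C (\<iota> (Cod J u)) (FArr D u) = \<iota> (Dom J u))"

definition is_colimit :: "('i, 'k) cat \<Rightarrow> ('o, 'a) cat \<Rightarrow> ('i, 'k, 'o, 'a) func \<Rightarrow>
  'o \<Rightarrow> bool" where
  "is_colimit J C D x \<longleftrightarrow> (\<exists>\<iota>. is_cocone J C D x \<iota> \<and>
     (\<forall>y \<kappa>. is_cocone J C D y \<kappa> \<longrightarrow>
        (\<exists>!h. h \<in> Hom C x y \<and> (\<forall>j\<in>Obj J. Comp C h (\<iota> j) = \<kappa> j))))"

type_synonym 'v set_arr = "'v set \<times> 'v set \<times> ('v \<Rightarrow> 'v)"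

definition Set :: "('v set \<Rightarrow> bool) \<Rightarrow> ('v set, 'v set_arr) cat" where
  "Set small =
     \<lparr>Obj = {A. small A},
      Arr = {(A, B, f). small A \<and> small B \<and> f \<in> A \<rightarrow>\<^sub>E B},
      Dom = (\<lambda>(A, B, f). A),
      Cod = (\<lambda>(A, B, f). B),
      Ide = (\<lambda>A. (A, A, \<lambda>a\<in>A. a)),
      Comp = (\<lambda>(B, C, g) (A, B', f). (A, C, compose A g f))\<rparr>"

type_synonym ('o, 'v) presheaf = "('o, 'v, 'v set, 'v set_arr) func"

definition presheaf_category :: "('v set \<Rightarrow> bool) \<Rightarrow> ('o, 'v) cat \<Rightarrow>
  (('o, 'v) presheaf,
   ('o, 'v) presheaf \<times> ('o, 'v) presheaf \<times> ('o \<Rightarrow> 'v set_arr)) cat" where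
  "presheaf_category small C = functor_category (opposite C) (Set small)"

definition representable :: "('o, 'v) cat \<Rightarrow> 'o \<Rightarrow> ('o, 'v) presheaf" where
  "representable C x =
     \<lparr>FObj = (\<lambda>z\<in>Obj C. Hom C z x),
      FArr = (\<lambda>f\<in>Arr C. (Hom C (Cod C f) x, Hom C (Dom C f) x,
                         \<lambda>g\<in>Hom C (Cod C f) x. Comp C g f))\<rparr>"

definition yoneda :: "('o, 'v) cat \<Rightarrow>
  ('o, 'v, ('o, 'v) presheaf,
   ('o, 'v) presheaf \<times> ('o, 'v) presheaf \<times> ('o \<Rightarrow> 'v set_arr)) func" where
  "yoneda C =
     \<lparr>FObj = representable C,
      FArr = (\<lambda>f. (representable C (Dom C f), representable C (Cod C f),
                   \<lambda>z\<in>Obj C. (Hom C z (Dom C f), Hom C z (Cod C f),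
                               \<lambda>g\<in>Hom C z (Dom C f). Comp C f g)))\<rparr>"

text \<open>The image presheaf of a diagram is determined up to isomorphism only.\<close>

definition is_image_presheaf :: "('v set \<Rightarrow> bool) \<Rightarrow> ('o, 'v) cat \<Rightarrow> ('i, 'k) cat \<Rightarrow>
  ('i, 'k, 'o, 'v) func \<Rightarrow> ('o, 'v) presheaf \<Rightarrow> bool" where
  "is_image_presheaf small C J D P \<longleftrightarrow>
     is_colimit J (presheaf_category small C) (functor_comp (yoneda C) D) P"

definition absolute_colimit :: "('v set \<Rightarrow> bool) \<Rightarrow> ('o, 'v) cat \<Rightarrow> ('i, 'k) cat \<Rightarrow>
  ('i, 'k, 'o, 'v) func \<Rightarrow> 'o \<Rightarrow> bool" where
  "absolute_colimit small C J D X \<longleftrightarrow> (\<exists>P. is_image_presheaf small C J D P \<and>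
     isomorphic (presheaf_category small C) P (representable C X))"

text \<open>The category \<open>b/F\<close>; an arrow carries its domain and codomain along.\<close>

definition comma :: "('o, 'a) cat \<Rightarrow> ('p, 'b) cat \<Rightarrow> 'p \<Rightarrow> ('o, 'a, 'p, 'b) func \<Rightarrow>
  ('o \<times> 'b, ('o \<times> 'b) \<times> ('o \<times> 'b) \<times> 'a) cat" where
  "comma A B b F =
     (let K = {(a, f). a \<in> Obj A \<and> f \<in> Hom B b (FObj F a)}
      in \<lparr>Obj = K,
          Arr = {(s, t, u). s \<in> K \<and> t \<in> K \<and> u \<in> Hom A (fst s) (fst t)
                    \<and> Comp B (FArr F u) (snd s) = snd t},
          Dom = (\<lambda>(s, t, u). s),
          Cod = (\<lambda>(s, t, u). t),
          Ide = (\<lambda>s. (s, s, Ide A (fst s))),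
          Comp = (\<lambda>(t, r, v) (s, t', u). (s, r, Comp A v u))\<rparr>)"

definition connected_category :: "('o, 'a) cat \<Rightarrow> bool" where
  "connected_category K \<longleftrightarrow>
     (\<forall>x\<in>Obj K. \<forall>y\<in>Obj K. equivclp (\<lambda>s t. Hom K s t \<noteq> {}) x y)"

definition confinal :: "('o, 'a) cat \<Rightarrow> ('p, 'b) cat \<Rightarrow> ('o, 'a, 'p, 'b) func \<Rightarrow> bool" where
  "confinal A B F \<longleftrightarrow> is_functor A B F \<and>
     (\<forall>b\<in>Obj B. Obj (comma A B b F) \<noteq> {} \<and> connected_category (comma A B b F))"

definition terminal_cat :: "('o, 'a) cat" where
  "terminal_cat = \<lparr>Obj = {undefined}, Arr = {undefined}, Dom = (\<lambda>_. undefined),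
     Cod = (\<lambda>_. undefined), Ide = (\<lambda>_. undefined), Comp = (\<lambda>_ _. undefined)\<rparr>"

definition object_functor :: "('o, 'a) cat \<Rightarrow> 'o \<Rightarrow> ('i, 'k, 'o, 'a) func" where
  "object_functor C x = \<lparr>FObj = (\<lambda>_. x), FArr = (\<lambda>_. Ide C x)\<rparr>"

type_synonym 'v diagram = "('v, 'v) cat \<times> ('v, 'v, 'v, 'v) func"

definition Cat_over_obj :: "('v set \<Rightarrow> bool) \<Rightarrow> ('v, 'v) cat \<Rightarrow> 'v diagram \<Rightarrow> bool" where
  "Cat_over_obj small C = (\<lambda>(S, P). small_category small S \<and> is_functor S C P)"

definition Cat_over_arr :: "('v set \<Rightarrow> bool) \<Rightarrow> ('v, 'v) cat \<Rightarrow> 'v diagram \<Rightarrow> 'v diagram \<Rightarrow>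
  ('v, 'v, 'v, 'v) func \<Rightarrow> bool" where
  "Cat_over_arr small C = (\<lambda>(S, P) (T, Q) G.
     Cat_over_obj small C (S, P) \<and> Cat_over_obj small C (T, Q) \<and>
     is_functor S T G \<and> functor_eq S (functor_comp Q G) P)"

text \<open>
  Since \<^const>\<open>equivclp\<close> is the equivalence closure, this relates two diagrams iff a finite
  chain of confinal arrows of Cat/C, each pointing in either direction, joins them.
\<close>

definition confinal_zigzag :: "('v set \<Rightarrow> bool) \<Rightarrow> ('v, 'v) cat \<Rightarrow>
  'v diagram \<Rightarrow> 'v diagram \<Rightarrow> bool" where
  "confinal_zigzag small C =
     equivclp (\<lambda>\<S> \<T>. \<exists>G. Cat_over_arr small C \<S> \<T> G \<and> confinal (fst \<S>) (fst \<T>) G)"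

end

theory Submission imports Defs begin

text \<open>
  The implications form a cycle (1) \<open>\<Rightarrow>\<close> (2) \<open>\<Rightarrow>\<close> (3) \<open>\<Rightarrow>\<close> (1). For (1) \<open>\<Rightarrow>\<close> (2), cocones under \<open>F D\<close> are
  cocones under the representables with vertex the presheaf \<open>Hom(F -, e)\<close>. For (2) \<open>\<Rightarrow>\<close> (3), embed
  \<open>C\<close> in its collage with the presheaf \<open>z \<mapsto> \<pi>\<^sub>0(z/D)\<close>, which is locally small although presheaf
  categories need not fit into the given universe. That the embedding preserves the colimit yields
  a cocone \<open>\<iota>\<close> and a section \<open>s\<close> of some \<open>\<iota> i\<close> such that \<open>s (\<iota> j)\<close> and the identity lie in the same
  component of \<open>D j/D\<close> for every \<open>j\<close>. Then \<open>\<iota>\<close> is a confinal functor from \<open>J\<close> to the slice over \<open>X\<close>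
  of a small full subcategory, where the identity of \<open>X\<close> is terminal. For (3) \<open>\<Rightarrow>\<close> (1), restriction
  along a confinal functor preserves and reflects colimits, in particular of presheaves.
\<close>

section \<open>Categories, functors and cocones\<close>

lemma (in category) Hom_Obj:
  assumes "f \<in> Hom C x y"
  shows "x \<in> Obj C" "y \<in> Obj C"
  using assms Dom_Obj Cod_Obj by (auto simp: Hom_def)

lemma Hom_Arr:
  assumes "f \<in> Hom C x y"
  shows "f \<in> Arr C" "Dom C f = x" "Cod C f = y"
  using assms by (auto simp: Hom_def)

lemma Arr_Hom: "f \<in> Arr C \<Longrightarrow> f \<in> Hom C (Dom C f) (Cod C f)"
  by (simp add: Hom_def)

lemma functor_Obj: "is_functor A B F \<Longrightarrow> x \<in> Obj A \<Longrightarrow> FObj F x \<in> Obj B"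
  by (simp add: is_functor_def)

lemma functor_Hom:
  "is_functor A B F \<Longrightarrow> f \<in> Hom A x y \<Longrightarrow> FArr F f \<in> Hom B (FObj F x) (FObj F y)"
  by (auto simp: is_functor_def Hom_def)

lemma functor_Ide: "is_functor A B F \<Longrightarrow> x \<in> Obj A \<Longrightarrow> FArr F (Ide A x) = Ide B (FObj F x)"
  by (simp add: is_functor_def)

lemma functor_Comp:
  "is_functor A B F \<Longrightarrow> f \<in> Hom A x y \<Longrightarrow> g \<in> Hom A y z \<Longrightarrow>
    FArr F (Comp A g f) = Comp B (FArr F g) (FArr F f)"
  by (auto simp: is_functor_def Hom_def)

lemma is_functorI:
  assumes "\<And>x. x \<in> Obj A \<Longrightarrow> FObj F x \<in> Obj B"
    and "\<And>x y f. f \<in> Hom A x y \<Longrightarrow> FArr F f \<in> Hom B (FObj F x) (FObj F y)"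
    and "\<And>x. x \<in> Obj A \<Longrightarrow> FArr F (Ide A x) = Ide B (FObj F x)"
    and "\<And>x y z f g. f \<in> Hom A x y \<Longrightarrow> g \<in> Hom A y z \<Longrightarrow>
      FArr F (Comp A g f) = Comp B (FArr F g) (FArr F f)"
  shows "is_functor A B F"
  unfolding is_functor_def using assms Arr_Hom by metis

lemma functor_comp_simps [simp]:
  "FObj (functor_comp G F) x = FObj G (FObj F x)"
  "FArr (functor_comp G F) f = FArr G (FArr F f)"
  by (simp_all add: functor_comp_def)

lemma functor_comp_is_functor:
  assumes F: "is_functor A B F" and G: "is_functor B E G"
  shows "is_functor A E (functor_comp G F)"
  by (rule is_functorI)
    (simp_all add: functor_Obj[OF F] functor_Obj[OF G] functor_Hom[OF F] functor_Hom[OF G]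
      functor_Ide[OF F] functor_Ide[OF G] functor_Comp[OF F]
      functor_Comp[OF G functor_Hom[OF F] functor_Hom[OF F]])

lemma cocone_Hom: "is_cocone J C D x \<iota> \<Longrightarrow> j \<in> Obj J \<Longrightarrow> \<iota> j \<in> Hom C (FObj D j) x"
  by (simp add: is_cocone_def)

lemma cocone_Comp:
  "is_cocone J C D x \<iota> \<Longrightarrow> u \<in> Hom J i j \<Longrightarrow> Comp C (\<iota> j) (FArr D u) = \<iota> i"
  by (auto simp: is_cocone_def Hom_def)

lemma is_coconeI:
  assumes "x \<in> Obj C" and "\<And>j. j \<in> Obj J \<Longrightarrow> \<iota> j \<in> Hom C (FObj D j) x"
    and "\<And>i j u. u \<in> Hom J i j \<Longrightarrow> Comp C (\<iota> j) (FArr D u) = \<iota> i"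
  shows "is_cocone J C D x \<iota>"
  unfolding is_cocone_def using assms Arr_Hom by metis

lemma is_cocone_functor:
  assumes "category J" and F: "is_functor C E F" and D: "is_functor J C D"
    and c: "is_cocone J C D x \<iota>"
  shows "is_cocone J E (functor_comp F D) (FObj F x) (\<lambda>j. FArr F (\<iota> j))"
proof (rule is_coconeI)
  show "FObj F x \<in> Obj E" using c functor_Obj[OF F] by (simp add: is_cocone_def)
  show "FArr F (\<iota> j) \<in> Hom E (FObj (functor_comp F D) j) (FObj F x)" if "j \<in> Obj J" for j
    using functor_Hom[OF F cocone_Hom[OF c that]] by simp
  show "Comp E (FArr F (\<iota> j)) (FArr (functor_comp F D) u) = FArr F (\<iota> i)"
    if u: "u \<in> Hom J i j" for i j u
  proof -
    have "\<iota> j \<in> Hom C (FObj D j) x"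
      using cocone_Hom[OF c] category.Hom_Obj(2)[OF \<open>category J\<close> u] .
    then have "FArr F (Comp C (\<iota> j) (FArr D u)) = Comp E (FArr F (\<iota> j)) (FArr F (FArr D u))"
      by (rule functor_Comp[OF F functor_Hom[OF D u]])
    then show ?thesis by (simp add: cocone_Comp[OF c u])
  qed
qed

section \<open>Confinal functors\<close>

lemma is_functor_terminal:
  assumes "category B" and "b \<in> Obj B"
  shows "is_functor terminal_cat B (object_functor B b)"
  using assms category.Ide_Hom[OF assms] category.Comp_Ide_left[OF \<open>category B\<close>]
  by (auto simp: is_functor_def object_functor_def terminal_cat_def)

lemma small_category_terminal: "smallness small \<Longrightarrow> small_category small terminal_cat"
  by (auto simp: small_category_def terminal_cat_def smallness.finite_small
      intro!: category.intro) (auto simp: Hom_def)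

text \<open>A cocone under a one-object diagram is a single arrow, the value at
  \<open>undefined\<close>, and it factors uniquely through the identity cocone. This settles the
  end \<open>terminal_cat\<close> of a zigzag.\<close>

lemma is_colimit_terminal:
  fixes C :: "('o, 'a) cat"
  assumes "category E" and R: "is_functor C E R" and X: "X \<in> Obj C"
  shows "is_colimit (terminal_cat :: ('i, 'k) cat) E
    (functor_comp R (object_functor C X)) (FObj R X)"
proof -
  interpret category E by fact
  let ?J = "terminal_cat :: ('i, 'k) cat" and ?D = "functor_comp R (object_functor C X)"
  let ?x = "FObj R X"
  have x: "?x \<in> Obj E" using functor_Obj[OF R X] .
  have i: "FArr R (Ide C X) = Ide E ?x" using functor_Ide[OF R X] .
  have "is_cocone ?J E ?D ?x (\<lambda>_. Ide E ?x)"
    using x Ide_Hom[OF x] Comp_Ide_left[OF Ide_Hom[OF x]]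
    by (simp add: is_cocone_def terminal_cat_def object_functor_def i)
  moreover have "\<exists>!h. h \<in> Hom E ?x y \<and> (\<forall>j\<in>Obj ?J. Comp E h (Ide E ?x) = \<kappa> j)"
    if "is_cocone ?J E ?D y \<kappa>" for y \<kappa>
  proof -
    have "\<kappa> undefined \<in> Hom E ?x y"
      using that by (simp add: is_cocone_def terminal_cat_def object_functor_def)
    then show ?thesis
      by (auto simp: terminal_cat_def Comp_Ide_right)
  qed
  ultimately show ?thesis unfolding is_colimit_def by blast
qed

lemma Obj_comma: "Obj (comma A B b F) = {(a, f). a \<in> Obj A \<and> f \<in> Hom B b (FObj F a)}"
  by (simp add: comma_def)

lemma Hom_comma_iff:
  "Hom (comma A B b F) s t \<noteq> {} \<longleftrightarrow> s \<in> Obj (comma A B b F) \<and> t \<in> Obj (comma A B b F) \<and>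
    (\<exists>u\<in>Hom A (fst s) (fst t). Comp B (FArr F u) (snd s) = snd t)"
  by (auto simp: comma_def Hom_def)

text \<open>The invariant may be of any type: below it is a composite with a cocone, membership in a
  comma category, or the truth value of being a colimit.\<close>

lemma equivclp_invariant:
  assumes "equivclp r x y" and "\<And>x y. r x y \<Longrightarrow> f x = f y"
  shows "f x = f y"
  using assms(1)
proof (induction rule: equivclp_induct)
  case (step y z)
  then show ?case using assms(2)[of y z] assms(2)[of z y] by auto
qed simp

text \<open>Along an arrow \<open>u\<close> of the comma category the cocone equation for
  \<open>u\<close> absorbs \<open>K (G u)\<close>, so the composite does not change. Besides
  confinal functors, this serves the case where \<open>G\<close> is the diagram \<open>D\<close> and
  \<open>K\<close> the identity.\<close>

lemma cocone_component_eq: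
  assumes "category E" and G: "is_functor S T G" and K: "is_functor T E K"
    and c: "is_cocone S E (functor_comp K G) y \<xi>"
    and conn: "equivclp (\<lambda>p q. Hom (comma S T t G) p q \<noteq> {}) p q"
  shows "Comp E (\<xi> (fst p)) (FArr K (snd p)) = Comp E (\<xi> (fst q)) (FArr K (snd q))"
  using conn
proof (rule equivclp_invariant)
  interpret E: category E by fact
  fix p q assume "Hom (comma S T t G) p q \<noteq> {}"
  then obtain u where u: "u \<in> Hom S (fst p) (fst q)" "Comp T (FArr G u) (snd p) = snd q"
    and p: "snd p \<in> Hom T t (FObj G (fst p))" and q: "fst q \<in> Obj S"
    unfolding Hom_comma_iff Obj_comma by auto
  have Gu: "FArr G u \<in> Hom T (FObj G (fst p)) (FObj G (fst q))"
    using functor_Hom[OF G u(1)] .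
  have "\<xi> (fst q) \<in> Hom E (FObj K (FObj G (fst q))) y"
    using cocone_Hom[OF c q] by simp
  then have "Comp E (\<xi> (fst q)) (FArr K (snd q)) =
      Comp E (Comp E (\<xi> (fst q)) (FArr K (FArr G u))) (FArr K (snd p))"
    using E.Comp_assoc[OF functor_Hom[OF K p] functor_Hom[OF K Gu]]
      functor_Comp[OF K p Gu] u(2) by metis
  then show "Comp E (\<xi> (fst p)) (FArr K (snd p)) = Comp E (\<xi> (fst q)) (FArr K (snd q))"
    using cocone_Comp[OF c u(1)] by simp
qed

locale confinal_functor = S: category S + T: category T + E: category E
  for S :: "('o, 'a) cat" and T :: "('p, 'b) cat" and E :: "('q, 'c) cat" +
  fixes G :: "('o, 'a, 'p, 'b) func" and K :: "('p, 'b, 'q, 'c) func"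
  assumes confinal: "confinal S T G" and K: "is_functor T E K"
begin

lemma G: "is_functor S T G"
  using confinal by (simp add: confinal_def)

lemma comma_nonempty:
  assumes "t \<in> Obj T"
  obtains s f where "s \<in> Obj S" "f \<in> Hom T t (FObj G s)"
proof -
  have "Obj (comma S T t G) \<noteq> {}"
    using confinal assms unfolding confinal_def by blast
  then show thesis using that by (auto simp: Obj_comma)
qed

lemma cocone_comma_eq:
  assumes c: "is_cocone S E (functor_comp K G) y \<xi>"
    and s: "s \<in> Obj S" "f \<in> Hom T t (FObj G s)" and s': "s' \<in> Obj S" "f' \<in> Hom T t (FObj G s')"
  shows "Comp E (\<xi> s) (FArr K f) = Comp E (\<xi> s') (FArr K f')"
proof -
  have "t \<in> Obj T" using T.Hom_Obj[OF s(2)] by simp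
  then have "equivclp (\<lambda>p q. Hom (comma S T t G) p q \<noteq> {}) (s, f) (s', f')"
    using confinal s s' by (auto simp: confinal_def connected_category_def Obj_comma)
  then show ?thesis
    using cocone_component_eq[OF E.category_axioms G K c] by force
qed

lemma restrict_cocone:
  assumes c: "is_cocone T E K y \<mu>"
  shows "is_cocone S E (functor_comp K G) y (\<lambda>s. \<mu> (FObj G s))"
proof (rule is_coconeI)
  show "y \<in> Obj E" using c by (simp add: is_cocone_def)
  show "\<mu> (FObj G j) \<in> Hom E (FObj (functor_comp K G) j) y" if "j \<in> Obj S" for j
    using cocone_Hom[OF c functor_Obj[OF G that]] by simp
  show "Comp E (\<mu> (FObj G j)) (FArr (functor_comp K G) u) = \<mu> (FObj G i)"
    if "u \<in> Hom S i j" for i j u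
    using cocone_Comp[OF c functor_Hom[OF G that]] by simp
qed

text \<open>The only possible value at \<open>t\<close> is \<open>\<xi> s\<close> after
  \<open>K f\<close> for an object \<open>(s, f)\<close> of \<open>t/G\<close>. Non-emptiness
  provides such an object, and connectedness makes the value independent of it.\<close>

lemma extend_cocone:
  assumes c: "is_cocone S E (functor_comp K G) y \<xi>"
  obtains \<mu> where "is_cocone T E K y \<mu>" "\<And>s. s \<in> Obj S \<Longrightarrow> \<mu> (FObj G s) = \<xi> s"
proof -
  \<comment> \<open>One common value \<open>m\<close> for all objects of \<open>t/G\<close> lets
    \<open>\<mu>\<close> be chosen together with its formula at every \<open>(s, f)\<close>, since
    different pairs are used below.\<close>
  have "\<exists>m. \<forall>s f. s \<in> Obj S \<longrightarrow> f \<in> Hom T t (FObj G s) \<longrightarrow> m = Comp E (\<xi> s) (FArr K f)"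
    if t: "t \<in> Obj T" for t
  proof -
    obtain s f where s: "s \<in> Obj S" "f \<in> Hom T t (FObj G s)" using comma_nonempty[OF t] .
    show ?thesis
      using cocone_comma_eq[OF c _ _ s] by (intro exI[of _ "Comp E (\<xi> s) (FArr K f)"]) metis
  qed
  then obtain \<mu> where \<mu>: "\<And>t s f. \<lbrakk>t \<in> Obj T; s \<in> Obj S; f \<in> Hom T t (FObj G s)\<rbrakk> \<Longrightarrow>
      \<mu> t = Comp E (\<xi> s) (FArr K f)" by metis
  have \<xi>: "\<xi> s \<in> Hom E (FObj K (FObj G s)) y" if "s \<in> Obj S" for s
    using cocone_Hom[OF c that] by simp
  have "is_cocone T E K y \<mu>"
  proof (rule is_coconeI)
    show "y \<in> Obj E" using c by (simp add: is_cocone_def)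
    show "\<mu> t \<in> Hom E (FObj K t) y" if t: "t \<in> Obj T" for t
    proof -
      obtain s f where "s \<in> Obj S" "f \<in> Hom T t (FObj G s)" using comma_nonempty[OF t] .
      then show ?thesis
        using \<mu>[OF t] E.Comp_Hom[OF functor_Hom[OF K] \<xi>] by metis
    qed
    show "Comp E (\<mu> t) (FArr K u) = \<mu> r" if u: "u \<in> Hom T r t" for r t u
    proof -
      have t: "t \<in> Obj T" and r: "r \<in> Obj T" using T.Hom_Obj[OF u] by auto
      obtain s f where s: "s \<in> Obj S" and f: "f \<in> Hom T t (FObj G s)"
        using comma_nonempty[OF t] .
      have "Comp E (\<mu> t) (FArr K u) = Comp E (\<xi> s) (FArr K (Comp T f u))"
        using E.Comp_assoc[OF functor_Hom[OF K u] functor_Hom[OF K f] \<xi>[OF s]]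
          \<mu>[OF t s f] functor_Comp[OF K u f] by simp
      also have "\<dots> = \<mu> r" using \<mu>[OF r s T.Comp_Hom[OF u f]] by simp
      finally show ?thesis .
    qed
  qed
  \<comment> \<open>The formula for \<open>\<mu>\<close> is evaluated at the pair of
    \<open>s\<close> and the identity of \<open>G s\<close>.\<close>
  moreover have "\<mu> (FObj G s) = \<xi> s" if s: "s \<in> Obj S" for s
  proof -
    have "FObj G s \<in> Obj T" using functor_Obj[OF G s] .
    then show ?thesis
      using \<mu>[OF _ s T.Ide_Hom] functor_Ide[OF K] E.Comp_Ide_right[OF \<xi>[OF s]] by metis
  qed
  ultimately show thesis using that by blast
qed

text \<open>The leg \<open>\<mu> t\<close> is \<open>\<mu> (G s)\<close> after \<open>K f\<close>,
  and \<open>\<nu> t\<close> factors through the same \<open>K f\<close>, so the equations at the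
  objects \<open>G s\<close> imply all others.\<close>

lemma cocone_morphism_iff:
  assumes \<mu>: "is_cocone T E K x \<mu>" and \<nu>: "is_cocone T E K y \<nu>" and h: "h \<in> Hom E x y"
  shows "(\<forall>t\<in>Obj T. Comp E h (\<mu> t) = \<nu> t) \<longleftrightarrow>
    (\<forall>s\<in>Obj S. Comp E h (\<mu> (FObj G s)) = \<nu> (FObj G s))"
proof (intro iffI ballI)
  fix t assume *: "\<forall>s\<in>Obj S. Comp E h (\<mu> (FObj G s)) = \<nu> (FObj G s)" and t: "t \<in> Obj T"
  obtain s f where s: "s \<in> Obj S" and f: "f \<in> Hom T t (FObj G s)"
    using comma_nonempty[OF t] .
  show "Comp E h (\<mu> t) = \<nu> t"
    using E.Comp_assoc[OF functor_Hom[OF K f] cocone_Hom[OF \<mu> functor_Obj[OF G s]] h]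
      cocone_Comp[OF \<mu> f] cocone_Comp[OF \<nu> f] * s by simp
qed (simp add: functor_Obj[OF G])

text \<open>Restriction and \<open>extend_cocone\<close> match the cocones over \<open>S\<close> and
  \<open>T\<close> with a given vertex, and by \<open>cocone_morphism_iff\<close> matching cocones
  have the same comparison arrows. So the two universal properties coincide.\<close>

lemma is_colimit_iff: "is_colimit S E (functor_comp K G) y \<longleftrightarrow> is_colimit T E K y"
proof
  assume "is_colimit S E (functor_comp K G) y"
  then obtain \<xi> where \<xi>: "is_cocone S E (functor_comp K G) y \<xi>"
    and univ: "\<And>x \<kappa>. is_cocone S E (functor_comp K G) x \<kappa> \<Longrightarrow>
      \<exists>!h. h \<in> Hom E y x \<and> (\<forall>s\<in>Obj S. Comp E h (\<xi> s) = \<kappa> s)"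
    unfolding is_colimit_def by blast
  obtain \<mu> where \<mu>: "is_cocone T E K y \<mu>" "\<And>s. s \<in> Obj S \<Longrightarrow> \<mu> (FObj G s) = \<xi> s"
    using extend_cocone[OF \<xi>] by blast
  have "\<exists>!h. h \<in> Hom E y x \<and> (\<forall>t\<in>Obj T. Comp E h (\<mu> t) = \<nu> t)"
    if \<nu>: "is_cocone T E K x \<nu>" for x \<nu>
    using univ[OF restrict_cocone[OF \<nu>]] cocone_morphism_iff[OF \<mu>(1) \<nu>] \<mu>(2)
    by (simp cong: conj_cong)
  then show "is_colimit T E K y" using \<mu>(1) unfolding is_colimit_def by blast
next
  assume "is_colimit T E K y"
  then obtain \<mu> where \<mu>: "is_cocone T E K y \<mu>"
    and univ: "\<And>x \<nu>. is_cocone T E K x \<nu> \<Longrightarrow>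
      \<exists>!h. h \<in> Hom E y x \<and> (\<forall>t\<in>Obj T. Comp E h (\<mu> t) = \<nu> t)"
    unfolding is_colimit_def by blast
  have "\<exists>!h. h \<in> Hom E y x \<and> (\<forall>s\<in>Obj S. Comp E h (\<mu> (FObj G s)) = \<kappa> s)"
    if \<kappa>: "is_cocone S E (functor_comp K G) x \<kappa>" for x \<kappa>
  proof -
    obtain \<nu> where \<nu>: "is_cocone T E K x \<nu>" "\<And>s. s \<in> Obj S \<Longrightarrow> \<nu> (FObj G s) = \<kappa> s"
      using extend_cocone[OF \<kappa>] by blast
    show ?thesis
      using univ[OF \<nu>(1)] cocone_morphism_iff[OF \<mu> \<nu>(1)] \<nu>(2) by (simp cong: conj_cong)
  qed
  then show "is_colimit S E (functor_comp K G) y"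
    using restrict_cocone[OF \<mu>] unfolding is_colimit_def by blast
qed

end

lemma is_cocone_cong:
  assumes eq: "functor_eq J F G"
  shows "is_cocone J C F x \<iota> \<longleftrightarrow> is_cocone J C G x \<iota>"
  using eq by (simp add: is_cocone_def functor_eq_def)

lemma is_colimit_cong:
  assumes "functor_eq J F G"
  shows "is_colimit J C F x \<longleftrightarrow> is_colimit J C G x"
  unfolding is_colimit_def is_cocone_cong[OF assms] ..

lemma is_colimit_confinal_zigzag:
  assumes "category E" and R: "is_functor C E R" and "confinal_zigzag small C \<S> \<T>"
  shows "is_colimit (fst \<S>) E (functor_comp R (snd \<S>)) y \<longleftrightarrow>
    is_colimit (fst \<T>) E (functor_comp R (snd \<T>)) y"
\<comment> \<open>The invariant is the truth value of \<open>y\<close> being a colimit of the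
  diagram followed by \<open>R\<close>. It remains to treat a single confinal arrow.\<close>
proof (rule equivclp_invariant[OF assms(3)[unfolded confinal_zigzag_def]])
  fix \<S> \<T> :: "'c diagram"
  assume "\<exists>G. Cat_over_arr small C \<S> \<T> G \<and> confinal (fst \<S>) (fst \<T>) G"
  then obtain G S P T Q where [simp]: "\<S> = (S, P)" "\<T> = (T, Q)" and G: "confinal S T G"
    and S: "category S" and T: "category T" and Q: "is_functor T C Q"
    and eq: "functor_eq S (functor_comp Q G) P"
    by (cases \<S>, cases \<T>) (auto simp: Cat_over_arr_def Cat_over_obj_def small_category_def)
  interpret confinal_functor S T E G "functor_comp R Q"
    using S T G \<open>category E\<close> functor_comp_is_functor[OF Q R]
    by (simp add: confinal_functor_def confinal_functor_axioms_def)
  \<comment> \<open>The triangle over \<open>C\<close> commutes on the objects and arrows of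
    \<open>S\<close> only, so \<open>P\<close> is exchanged through \<open>is_colimit_cong\<close>
    and not by an equality of functors.\<close>
  have "functor_eq S (functor_comp R P) (functor_comp (functor_comp R Q) G)"
    using eq by (simp add: functor_eq_def)
  then show "is_colimit (fst \<S>) E (functor_comp R (snd \<S>)) y \<longleftrightarrow>
      is_colimit (fst \<T>) E (functor_comp R (snd \<T>)) y"
    using is_colimit_iff is_colimit_cong by (metis fst_conv snd_conv \<open>\<S> = (S, P)\<close> \<open>\<T> = (T, Q)\<close>)
qed

section \<open>Presheaves and the Yoneda lemma\<close>

lemma category_opposite: "category C \<Longrightarrow> category (opposite C)"
  by (auto simp: category_def opposite_def Hom_def)

lemma opposite_simps [simp]:
  "Obj (opposite C) = Obj C" "Arr (opposite C) = Arr C"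
  "Dom (opposite C) = Cod C" "Cod (opposite C) = Dom C"
  "Ide (opposite C) = Ide C" "Comp (opposite C) g f = Comp C f g"
  by (simp_all add: opposite_def)

lemma Hom_opposite [simp]: "Hom (opposite C) x y = Hom C y x"
  by (auto simp: Hom_def)

lemma Hom_Set:
  "Hom (Set small) A B = {(A', B', f). A' = A \<and> B' = B \<and> small A \<and> small B \<and> f \<in> A \<rightarrow>\<^sub>E B}"
  by (auto simp: Hom_def Set_def)

lemma Set_simps [simp]:
  "Obj (Set small) = {A. small A}"
  "Ide (Set small) A = (A, A, \<lambda>a\<in>A. a)"
  "Comp (Set small) (B, D, g) (A, B', f) = (A, D, compose A g f)"
  by (simp_all add: Set_def)

lemma category_Set: "category (Set small)"
proof
  show "Comp (Set small) f (Ide (Set small) A) = f" if "f \<in> Hom (Set small) A B" for f A B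
    using that by (auto simp: Hom_Set intro!: ext simp: compose_def PiE_def extensional_def)
  show "Comp (Set small) (Ide (Set small) B) f = f" if "f \<in> Hom (Set small) A B" for f A B
    using that by (auto simp: Hom_Set intro!: ext simp: compose_def PiE_def extensional_def Pi_def) metis
  show "Comp (Set small) h (Comp (Set small) g f) = Comp (Set small) (Comp (Set small) h g) f"
    if "f \<in> Hom (Set small) A B" "g \<in> Hom (Set small) B D" "h \<in> Hom (Set small) D E" for f g h A B D E
    using that by (auto simp: Hom_Set compose_def intro!: restrict_ext) (metis PiE_mem)
  show "Comp (Set small) g f \<in> Hom (Set small) A D"
    if "f \<in> Hom (Set small) A B" "g \<in> Hom (Set small) B D" for f g A B D
    using that by (auto simp: Hom_Set compose_def) (metis PiE_mem)
qed (auto simp: Hom_def Set_def)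

section \<open>Functor categories and presheaf categories\<close>

lemma functor_category_simps:
  "Obj (functor_category A B) =
    {F. is_functor A B F \<and> FObj F \<in> extensional (Obj A) \<and> FArr F \<in> extensional (Arr A)}"
  "Ide (functor_category A B) F = (F, F, \<lambda>x\<in>Obj A. Ide B (FObj F x))"
  "Comp (functor_category A B) (G, H, \<theta>) (F, G', \<eta>) = (F, H, \<lambda>x\<in>Obj A. Comp B (\<theta> x) (\<eta> x))"
  by (simp_all add: functor_category_def)

lemma Hom_functor_category:
  "Hom (functor_category A B) F G =
    {(F', G', \<eta>). F' = F \<and> G' = G \<and> F \<in> Obj (functor_category A B) \<and>
      G \<in> Obj (functor_category A B) \<and> is_nat_trans A B F G \<eta> \<and> \<eta> \<in> extensional (Obj A)}"
  by (auto simp: Hom_def functor_category_def)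

lemma is_nat_transI:
  assumes "\<And>x. x \<in> Obj A \<Longrightarrow> \<eta> x \<in> Hom B (FObj F x) (FObj G x)"
    and "\<And>x y f. f \<in> Hom A x y \<Longrightarrow> Comp B (\<eta> y) (FArr F f) = Comp B (FArr G f) (\<eta> x)"
  shows "is_nat_trans A B F G \<eta>"
  unfolding is_nat_trans_def using assms Arr_Hom by metis

lemma nat_trans_Hom: "is_nat_trans A B F G \<eta> \<Longrightarrow> x \<in> Obj A \<Longrightarrow> \<eta> x \<in> Hom B (FObj F x) (FObj G x)"
  by (simp add: is_nat_trans_def)

lemma nat_trans_Comp:
  "is_nat_trans A B F G \<eta> \<Longrightarrow> f \<in> Hom A x y \<Longrightarrow> Comp B (\<eta> y) (FArr F f) = Comp B (FArr G f) (\<eta> x)"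
  by (auto simp: is_nat_trans_def Hom_def)

lemma is_nat_trans_Comp:
  assumes "category A" and "category B"
    and F: "is_functor A B F" and G: "is_functor A B G" and H: "is_functor A B H"
    and \<eta>: "is_nat_trans A B F G \<eta>" and \<theta>: "is_nat_trans A B G H \<theta>"
  shows "is_nat_trans A B F H (\<lambda>x\<in>Obj A. Comp B (\<theta> x) (\<eta> x))"
proof (rule is_nat_transI)
  interpret A: category A by fact
  interpret B: category B by fact
  show "(\<lambda>x\<in>Obj A. Comp B (\<theta> x) (\<eta> x)) x \<in> Hom B (FObj F x) (FObj H x)" if "x \<in> Obj A" for x
    using that B.Comp_Hom[OF nat_trans_Hom[OF \<eta> that] nat_trans_Hom[OF \<theta> that]] by simp
  show "Comp B ((\<lambda>x\<in>Obj A. Comp B (\<theta> x) (\<eta> x)) y) (FArr F f) =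
      Comp B (FArr H f) ((\<lambda>x\<in>Obj A. Comp B (\<theta> x) (\<eta> x)) x)"
    if f: "f \<in> Hom A x y" for x y f
  proof -
    have x: "x \<in> Obj A" and y: "y \<in> Obj A" using A.Hom_Obj[OF f] by auto
    note Ff = functor_Hom[OF F f] and Gf = functor_Hom[OF G f] and Hf = functor_Hom[OF H f]
    note e = nat_trans_Hom[OF \<eta>] and t = nat_trans_Hom[OF \<theta>]
    have "Comp B (Comp B (\<theta> y) (\<eta> y)) (FArr F f) = Comp B (\<theta> y) (Comp B (FArr G f) (\<eta> x))"
      using B.Comp_assoc[OF Ff e[OF y] t[OF y]] nat_trans_Comp[OF \<eta> f] by simp
    also have "\<dots> = Comp B (Comp B (FArr H f) (\<theta> x)) (\<eta> x)"
      using B.Comp_assoc[OF e[OF x] Gf t[OF y]] nat_trans_Comp[OF \<theta> f] by simp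
    also have "\<dots> = Comp B (FArr H f) (Comp B (\<theta> x) (\<eta> x))"
      using B.Comp_assoc[OF e[OF x] t[OF x] Hf] by simp
    finally show ?thesis using x y by simp
  qed
qed

lemma category_functor_category:
  assumes "category A" and "category B"
  shows "category (functor_category A B)"
proof
  interpret A: category A by fact
  interpret B: category B by fact
  let ?C = "functor_category A B"
  show "Dom ?C f \<in> Obj ?C" "Cod ?C f \<in> Obj ?C" if "f \<in> Arr ?C" for f
    using that by (auto simp: functor_category_def)
  show "Ide ?C F \<in> Hom ?C F F" if F: "F \<in> Obj ?C" for F
  proof -
    have F': "is_functor A B F" using F by (simp add: functor_category_simps)
    have "is_nat_trans A B F F (\<lambda>x\<in>Obj A. Ide B (FObj F x))"
      by (rule is_nat_transI)
        (use A.Hom_Obj functor_Hom[OF F'] in \<open>auto simp: functor_Obj[OF F'] B.Ide_Hom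
          B.Comp_Ide_left[OF functor_Hom[OF F']] B.Comp_Ide_right[OF functor_Hom[OF F']]\<close>)
    then show ?thesis using F by (simp add: functor_category_simps(2) Hom_functor_category)
  qed
  show "Comp ?C g f \<in> Hom ?C F H" if "f \<in> Hom ?C F G" "g \<in> Hom ?C G H" for f g F G H
    using that is_nat_trans_Comp[OF assms]
    by (auto simp: Hom_functor_category functor_category_simps)
  show "Comp ?C f (Ide ?C F) = f" if "f \<in> Hom ?C F G" for f F G
    using that
    by (auto simp: Hom_functor_category functor_category_simps extensional_def
        intro!: ext B.Comp_Ide_right) (erule (1) nat_trans_Hom)
  show "Comp ?C (Ide ?C G) f = f" if "f \<in> Hom ?C F G" for f F G
    using that
    by (auto simp: Hom_functor_category functor_category_simps extensional_def
        intro!: ext B.Comp_Ide_left) (erule (1) nat_trans_Hom)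
  show "Comp ?C h (Comp ?C g f) = Comp ?C (Comp ?C h g) f"
    if "f \<in> Hom ?C F G" "g \<in> Hom ?C G H" "h \<in> Hom ?C H K" for f g h F G H K
    using that
    by (auto simp: Hom_functor_category functor_category_simps
        intro!: restrict_ext) (rule B.Comp_assoc; erule (1) nat_trans_Hom)
qed

lemma category_presheaf_category: "category C \<Longrightarrow> category (presheaf_category small C)"
  unfolding presheaf_category_def
  by (intro category_functor_category category_opposite category_Set)

section \<open>Nerves of functors and the Yoneda lemma\<close>

definition nerve :: "('o, 'v) cat \<Rightarrow> ('p, 'v) cat \<Rightarrow> ('o, 'v, 'p, 'v) func \<Rightarrow> 'p \<Rightarrow> ('o, 'v) presheaf" where
  "nerve C E F e =
     \<lparr>FObj = (\<lambda>z\<in>Obj C. Hom E (FObj F z) e),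
      FArr = (\<lambda>f\<in>Arr C. (Hom E (FObj F (Cod C f)) e, Hom E (FObj F (Dom C f)) e,
                         \<lambda>g\<in>Hom E (FObj F (Cod C f)) e. Comp E g (FArr F f)))\<rparr>"

text \<open>The transformation that the Yoneda lemma assigns to \<open>h\<close> in
  \<open>Hom(F x, e)\<close>, the value of the nerve at \<open>x\<close>. For \<open>F\<close> the
  identity it is the Yoneda embedding of \<open>h\<close>, so full faithfulness of the embedding is
  a special case.\<close>

definition yoneda_map :: "('o, 'v) cat \<Rightarrow> ('p, 'v) cat \<Rightarrow> ('o, 'v, 'p, 'v) func \<Rightarrow> 'o \<Rightarrow> 'p \<Rightarrow> 'v \<Rightarrow>
  ('o, 'v) presheaf \<times> ('o, 'v) presheaf \<times> ('o \<Rightarrow> 'v set_arr)" where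
  "yoneda_map C E F x e h =
     (representable C x, nerve C E F e,
      \<lambda>z\<in>Obj C. (Hom C z x, Hom E (FObj F z) e, \<lambda>g\<in>Hom C z x. Comp E h (FArr F g)))"

definition id_functor :: "('o, 'a, 'o, 'a) func" where
  "id_functor = \<lparr>FObj = (\<lambda>x. x), FArr = (\<lambda>f. f)\<rparr>"

lemma id_functor_simps [simp]: "FObj id_functor x = x" "FArr id_functor f = f"
  by (simp_all add: id_functor_def)

lemma id_functor_is_functor: "is_functor C C id_functor"
  by (auto simp: is_functor_def Arr_Hom)

lemma representable_eq_nerve: "representable C x = nerve C C id_functor x"
  by (simp add: representable_def nerve_def)

lemma yoneda_FObj: "FObj (yoneda C) x = representable C x"
  by (simp add: yoneda_def)

lemma yoneda_FArr: "f \<in> Hom C x y \<Longrightarrow> FArr (yoneda C) f = yoneda_map C C id_functor x y f"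
  by (simp add: yoneda_def yoneda_map_def representable_eq_nerve[symmetric] Hom_Arr)

locale nerve_setting = C: category C + E: category E
  for small :: "'v set \<Rightarrow> bool" and C :: "('o, 'v) cat" and E :: "('p, 'v) cat" +
  fixes F :: "('o, 'v, 'p, 'v) func"
  assumes small_C: "locally_small small C" and small_E: "locally_small small E"
    and F: "is_functor C E F"
begin

lemma nerve_is_functor:
  assumes e: "e \<in> Obj E"
  shows "is_functor (opposite C) (Set small) (nerve C E F e)"
proof (rule is_functorI)
  have sm: "small (Hom E (FObj F z) e)" if "z \<in> Obj C" for z
    using small_E functor_Obj[OF F that] e by (simp add: locally_small_def)
  show "FObj (nerve C E F e) z \<in> Obj (Set small)" if "z \<in> Obj (opposite C)" for z
    using that sm by (simp add: nerve_def)
  show "FArr (nerve C E F e) f \<in> Hom (Set small) (FObj (nerve C E F e) x) (FObj (nerve C E F e) y)"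
    if "f \<in> Hom (opposite C) x y" for x y f
  proof -
    have f: "f \<in> Hom C y x" using that by simp
    then show ?thesis
      using C.Hom_Obj[OF f] sm E.Comp_Hom[OF functor_Hom[OF F f]]
      by (auto simp: nerve_def Hom_Set Hom_Arr[OF f])
  qed
  show "FArr (nerve C E F e) (Ide (opposite C) x) = Ide (Set small) (FObj (nerve C E F e) x)"
    if "x \<in> Obj (opposite C)" for x
    using that Hom_Arr[OF C.Ide_Hom[of x]] E.Comp_Ide_right
    by (auto simp: nerve_def functor_Ide[OF F] intro!: restrict_ext)
  show "FArr (nerve C E F e) (Comp (opposite C) g f) =
      Comp (Set small) (FArr (nerve C E F e) g) (FArr (nerve C E F e) f)"
    if f: "f \<in> Hom (opposite C) x y" and g: "g \<in> Hom (opposite C) y z" for x y z f g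
  proof -
    have f: "f \<in> Hom C y x" and g: "g \<in> Hom C z y" using f g by simp_all
    have "Comp E h (FArr F (Comp C f g)) = Comp E (Comp E h (FArr F f)) (FArr F g)"
      and "Comp E h (FArr F f) \<in> Hom E (FObj F y) e"
      if "h \<in> Hom E (FObj F x) e" for h
      using E.Comp_assoc[OF functor_Hom[OF F g] functor_Hom[OF F f] that] functor_Comp[OF F g f]
        E.Comp_Hom[OF functor_Hom[OF F f] that] by simp_all
    then show ?thesis
      using Hom_Arr[OF f] Hom_Arr[OF g] Hom_Arr[OF C.Comp_Hom[OF g f]]
      by (auto simp: nerve_def compose_def intro!: restrict_ext)
  qed
qed

text \<open>Objects of a functor category are extensional, which the restricted abstractions in
  \<open>nerve\<close> ensure.\<close>

lemma nerve_Obj: "e \<in> Obj E \<Longrightarrow> nerve C E F e \<in> Obj (presheaf_category small C)"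
  unfolding presheaf_category_def
  by (simp add: functor_category_simps nerve_is_functor) (simp add: nerve_def)

end

text \<open>With the identity functor, statements on nerves become statements on representables, by
  \<open>representable_eq_nerve\<close>.\<close>

lemma (in nerve_setting) self: "nerve_setting small C C id_functor"
  by unfold_locales (simp_all add: small_C id_functor_is_functor)

lemma (in nerve_setting) representable_Obj:
  "x \<in> Obj C \<Longrightarrow> representable C x \<in> Obj (presheaf_category small C)"
  unfolding representable_eq_nerve by (rule nerve_setting.nerve_Obj[OF self])

context nerve_setting
begin

lemma yoneda_map_Hom:
  assumes x: "x \<in> Obj C" and h: "h \<in> Hom E (FObj F x) e"
  shows "yoneda_map C E F x e h \<in>
    Hom (presheaf_category small C) (representable C x) (nerve C E F e)"
proof -
  have e: "e \<in> Obj E" using E.Hom_Obj[OF h] by simp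
  let ?\<eta> = "\<lambda>z\<in>Obj C. (Hom C z x, Hom E (FObj F z) e, \<lambda>g\<in>Hom C z x. Comp E h (FArr F g))"
  have "is_nat_trans (opposite C) (Set small) (representable C x) (nerve C E F e) ?\<eta>"
  proof (rule is_nat_transI)
    show "?\<eta> z \<in> Hom (Set small) (FObj (representable C x) z) (FObj (nerve C E F e) z)"
      if "z \<in> Obj (opposite C)" for z
      using that small_C small_E x e functor_Obj[OF F] E.Comp_Hom[OF functor_Hom[OF F] h]
      by (auto simp: representable_def nerve_def Hom_Set locally_small_def)
    show "Comp (Set small) (?\<eta> w) (FArr (representable C x) f) =
        Comp (Set small) (FArr (nerve C E F e) f) (?\<eta> z)"
      if "f \<in> Hom (opposite C) z w" for z w f
    proof -
      have f: "f \<in> Hom C w z" using that by simp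
      have "Comp E h (FArr F (Comp C g f)) = Comp E (Comp E h (FArr F g)) (FArr F f)"
        and "Comp C g f \<in> Hom C w x" and "Comp E h (FArr F g) \<in> Hom E (FObj F z) e"
        if g: "g \<in> Hom C z x" for g
        using E.Comp_assoc[OF functor_Hom[OF F f] functor_Hom[OF F g] h] functor_Comp[OF F f g]
          C.Comp_Hom[OF f g] E.Comp_Hom[OF functor_Hom[OF F g] h] by simp_all
      then show ?thesis
        using Hom_Arr[OF f] C.Hom_Obj[OF f]
        by (auto simp: representable_def nerve_def compose_def intro!: restrict_ext)
    qed
  qed
  then show ?thesis
    using representable_Obj[OF x] nerve_Obj[OF e]
    by (simp add: presheaf_category_def Hom_functor_category yoneda_map_def)
qed

text \<open>The component at \<open>x\<close>, evaluated at the identity, recovers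
  \<open>h\<close>.\<close>

lemma yoneda_map_inj:
  assumes x: "x \<in> Obj C" and h: "h \<in> Hom E (FObj F x) e" and k: "k \<in> Hom E (FObj F x) e"
    and eq: "yoneda_map C E F x e h = yoneda_map C E F x e k"
  shows "h = k"
proof -
  have "Comp E h (FArr F (Ide C x)) = Comp E k (FArr F (Ide C x))"
    using eq x C.Ide_Hom[OF x] unfolding yoneda_map_def
    by (auto dest!: fun_cong[of _ _ x] fun_cong[of _ _ "Ide C x"])
  then show ?thesis
    using E.Comp_Ide_right[OF h] E.Comp_Ide_right[OF k] functor_Ide[OF F x] by simp
qed

text \<open>Here \<open>h\<close> is the value of the transformation at the identity of
  \<open>x\<close>, and naturality along \<open>g\<close> determines the value at every other
  \<open>g\<close>.\<close>

lemma yoneda_map_surj: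
  assumes x: "x \<in> Obj C" and e: "e \<in> Obj E"
    and \<tau>: "\<tau> \<in> Hom (presheaf_category small C) (representable C x) (nerve C E F e)"
  obtains h where "h \<in> Hom E (FObj F x) e" "\<tau> = yoneda_map C E F x e h"
proof -
  obtain \<eta> where \<tau>_eq: "\<tau> = (representable C x, nerve C E F e, \<eta>)"
    and nat: "is_nat_trans (opposite C) (Set small) (representable C x) (nerve C E F e) \<eta>"
    and ext: "\<eta> \<in> extensional (Obj C)"
    using \<tau> by (auto simp: presheaf_category_def Hom_functor_category)
  have "\<exists>t. \<eta> z = (Hom C z x, Hom E (FObj F z) e, t) \<and> t \<in> Hom C z x \<rightarrow>\<^sub>E Hom E (FObj F z) e"
    if "z \<in> Obj C" for z
    using nat_trans_Hom[OF nat, of z] that by (auto simp: representable_def nerve_def Hom_Set)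
  then obtain t where \<eta>: "\<And>z. z \<in> Obj C \<Longrightarrow> \<eta> z = (Hom C z x, Hom E (FObj F z) e, t z)"
    and t: "\<And>z. z \<in> Obj C \<Longrightarrow> t z \<in> Hom C z x \<rightarrow>\<^sub>E Hom E (FObj F z) e"
    by metis
  let ?h = "t x (Ide C x)"
  have h: "?h \<in> Hom E (FObj F x) e" using t[OF x] C.Ide_Hom[OF x] by auto
  have t_eq: "t z g = Comp E ?h (FArr F g)" if z: "z \<in> Obj C" and g: "g \<in> Hom C z x" for z g
  proof -
    have "Comp (Set small) (\<eta> z) (FArr (representable C x) g) =
        Comp (Set small) (FArr (nerve C E F e) g) (\<eta> x)"
      using nat_trans_Comp[OF nat, of g x z] g by simp
    \<comment> \<open>The naturality square of \<open>g\<close>, evaluated at the identity: one side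
      is \<open>t z g\<close>, the other is \<open>h\<close> after \<open>F g\<close>.\<close>
    then have "compose (Hom C x x) (t z) (\<lambda>k\<in>Hom C x x. Comp C k g) (Ide C x) =
        compose (Hom C x x) (\<lambda>k\<in>Hom E (FObj F x) e. Comp E k (FArr F g)) (t x) (Ide C x)"
      using x z by (simp add: \<eta> representable_def nerve_def Hom_Arr[OF g])
    then show ?thesis
      using C.Ide_Hom[OF x] h C.Comp_Ide_left[OF g] by (simp add: compose_def)
  qed
  have "\<eta> z = (\<lambda>z\<in>Obj C. (Hom C z x, Hom E (FObj F z) e, \<lambda>g\<in>Hom C z x. Comp E ?h (FArr F g))) z" for z
  proof (cases "z \<in> Obj C")
    case True
    have "t z = (\<lambda>g\<in>Hom C z x. Comp E ?h (FArr F g))"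
      using t[OF True] t_eq[OF True] by (auto simp: PiE_def extensional_def)
    then show ?thesis using True \<eta> by simp
  next
    case False
    then show ?thesis using ext by (simp add: extensional_def)
  qed
  then have "\<tau> = yoneda_map C E F x e ?h"
    unfolding \<tau>_eq yoneda_map_def by auto
  then show thesis using that h by blast
qed

text \<open>Naturality of the Yoneda correspondence in the representing object. For the identity
  functor this is compatibility of the Yoneda embedding with composition.\<close>

lemma yoneda_map_Comp:
  assumes f: "f \<in> Hom C w x" and h: "h \<in> Hom E (FObj F x) e"
  shows "Comp (presheaf_category small C) (yoneda_map C E F x e h) (FArr (yoneda C) f) =
    yoneda_map C E F w e (Comp E h (FArr F f))"
proof -
  have "Comp E h (FArr F (Comp C f g)) = Comp E (Comp E h (FArr F f)) (FArr F g)"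
    and "Comp C f g \<in> Hom C z x" if g: "g \<in> Hom C z w" for z g
    using E.Comp_assoc[OF functor_Hom[OF F g] functor_Hom[OF F f] h] functor_Comp[OF F g f]
      C.Comp_Hom[OF g f] by simp_all
  then show ?thesis
    unfolding yoneda_FArr[OF f]
    by (auto simp: presheaf_category_def yoneda_map_def functor_category_simps compose_def
        intro!: restrict_ext)
qed

interpretation self: nerve_setting small C C id_functor by (rule self)

lemma yoneda_is_functor: "is_functor C (presheaf_category small C) (yoneda C)"
proof (rule is_functorI)
  show "FObj (yoneda C) x \<in> Obj (presheaf_category small C)" if "x \<in> Obj C" for x
    using representable_Obj[OF that] by (simp add: yoneda_FObj)
  show "FArr (yoneda C) f \<in> Hom (presheaf_category small C) (FObj (yoneda C) x) (FObj (yoneda C) y)"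
    if f: "f \<in> Hom C x y" for f x y
    using self.yoneda_map_Hom[of x f y] f C.Hom_Obj[OF f]
    by (simp add: yoneda_FObj yoneda_FArr[OF f] representable_eq_nerve)
  show "FArr (yoneda C) (Ide C x) = Ide (presheaf_category small C) (FObj (yoneda C) x)"
    if x: "x \<in> Obj C" for x
    using x Hom_Arr[OF C.Ide_Hom[OF x]] C.Comp_Ide_left
    by (auto simp: yoneda_def presheaf_category_def functor_category_simps representable_def
        intro!: restrict_ext)
  show "FArr (yoneda C) (Comp C g f) =
      Comp (presheaf_category small C) (FArr (yoneda C) g) (FArr (yoneda C) f)"
    if f: "f \<in> Hom C x y" and g: "g \<in> Hom C y z" for f g x y z
    using self.yoneda_map_Comp[OF f, of g z] g
    by (simp add: yoneda_FArr[OF g] yoneda_FArr[OF C.Comp_Hom[OF f g]])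
qed

text \<open>
  By Yoneda, cocones \<open>F D \<rightarrow> e\<close> are cocones from the representables to the presheaf
  \<open>Hom(F -, e)\<close>, and arrows \<open>F x \<rightarrow> e\<close> are maps from the representable on \<open>x\<close> to it.
\<close>

lemma is_colimit_of_representables:
  assumes "category J" and D: "is_functor J C D" and x: "x \<in> Obj C"
    and col: "is_colimit J (presheaf_category small C) (functor_comp (yoneda C) D) (representable C x)"
  shows "is_colimit J E (functor_comp F D) (FObj F x)"
proof -
  interpret J: category J by fact
  let ?P = "presheaf_category small C" and ?y = "FArr (yoneda C)"
  obtain \<tau> where \<tau>: "is_cocone J ?P (functor_comp (yoneda C) D) (representable C x) \<tau>"
    and univ: "\<And>p \<kappa>. is_cocone J ?P (functor_comp (yoneda C) D) p \<kappa> \<Longrightarrow>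
      \<exists>!h. h \<in> Hom ?P (representable C x) p \<and> (\<forall>j\<in>Obj J. Comp ?P h (\<tau> j) = \<kappa> j)"
    using col unfolding is_colimit_def by blast
  note Dj = functor_Obj[OF D]
  \<comment> \<open>Each leg is a transformation between representables, so it comes from an arrow
    of \<open>C\<close> by fullness of the Yoneda embedding.\<close>
  have "\<exists>k. k \<in> Hom C (FObj D j) x \<and> \<tau> j = ?y k" if j: "j \<in> Obj J" for j
  proof -
    have \<tau>j: "\<tau> j \<in> Hom ?P (representable C (FObj D j)) (nerve C C id_functor x)"
      using cocone_Hom[OF \<tau> j] by (simp add: yoneda_FObj representable_eq_nerve)
    obtain k where "k \<in> Hom C (FObj D j) x" "\<tau> j = yoneda_map C C id_functor (FObj D j) x k"
      using self.yoneda_map_surj[OF Dj[OF j] x \<tau>j] unfolding id_functor_simps .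
    then show ?thesis using yoneda_FArr by metis
  qed
  then obtain \<iota> where \<iota>: "\<And>j. j \<in> Obj J \<Longrightarrow> \<iota> j \<in> Hom C (FObj D j) x"
    and \<tau>_eq: "\<And>j. j \<in> Obj J \<Longrightarrow> \<tau> j = ?y (\<iota> j)" by metis
  have "is_cocone J C D x \<iota>"
  proof (rule is_coconeI)
    fix i j u assume u: "u \<in> Hom J i j"
    then have i: "i \<in> Obj J" and j: "j \<in> Obj J" using J.Hom_Obj by auto
    note Du = functor_Hom[OF D u]
    \<comment> \<open>The cocone equation holds for the embedded arrows and descends to
      \<open>C\<close> by faithfulness.\<close>
    have "?y (Comp C (\<iota> j) (FArr D u)) = ?y (\<iota> i)"
      using cocone_Comp[OF \<tau> u] functor_Comp[OF yoneda_is_functor Du \<iota>[OF j]]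
      by (simp add: \<tau>_eq i j)
    then show "Comp C (\<iota> j) (FArr D u) = \<iota> i"
      using self.yoneda_map_inj[OF Dj[OF i]] C.Comp_Hom[OF Du \<iota>[OF j]] \<iota>[OF i] yoneda_FArr
      by (metis id_functor_simps(1))
  qed (use x \<iota> in auto)
  then have "is_cocone J E (functor_comp F D) (FObj F x) (\<lambda>j. FArr F (\<iota> j))"
    by (rule is_cocone_functor[OF \<open>category J\<close> F D])
  moreover have "\<exists>!h. h \<in> Hom E (FObj F x) e \<and> (\<forall>j\<in>Obj J. Comp E h (FArr F (\<iota> j)) = \<kappa> j)"
    if \<kappa>: "is_cocone J E (functor_comp F D) e \<kappa>" for e \<kappa>
  proof -
    let ?N = "nerve C E F e"
    have e: "e \<in> Obj E" using \<kappa> by (simp add: is_cocone_def)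
    have \<kappa>j: "\<kappa> j \<in> Hom E (FObj F (FObj D j)) e" if "j \<in> Obj J" for j
      using cocone_Hom[OF \<kappa> that] by simp
    let ?k = "\<lambda>j. yoneda_map C E F (FObj D j) e (\<kappa> j)"
    have "is_cocone J ?P (functor_comp (yoneda C) D) ?N ?k"
    proof (rule is_coconeI)
      show "?N \<in> Obj ?P" by (rule nerve_Obj[OF e])
      show "?k j \<in> Hom ?P (FObj (functor_comp (yoneda C) D) j) ?N" if "j \<in> Obj J" for j
        using yoneda_map_Hom[OF Dj[OF that] \<kappa>j[OF that]] by (simp add: yoneda_FObj)
      show "Comp ?P (?k j) (FArr (functor_comp (yoneda C) D) u) = ?k i"
        if u: "u \<in> Hom J i j" for i j u
        using yoneda_map_Comp[OF functor_Hom[OF D u] \<kappa>j] cocone_Comp[OF \<kappa> u] J.Hom_Obj[OF u]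
        by simp
    qed
    then have uni: "\<exists>!h. h \<in> Hom ?P (representable C x) ?N \<and> (\<forall>j\<in>Obj J. Comp ?P h (\<tau> j) = ?k j)"
      by (rule univ)
    \<comment> \<open>With this translation, existence follows from surjectivity of
      \<open>yoneda_map\<close> at \<open>x\<close>, and uniqueness from its injectivity
      there.\<close>
    have iff: "Comp ?P (yoneda_map C E F x e h) (\<tau> j) = ?k j \<longleftrightarrow> Comp E h (FArr F (\<iota> j)) = \<kappa> j"
      if h: "h \<in> Hom E (FObj F x) e" and j: "j \<in> Obj J" for h j
      using yoneda_map_Comp[OF \<iota>[OF j] h] \<tau>_eq[OF j] \<kappa>j[OF j]
        E.Comp_Hom[OF functor_Hom[OF F \<iota>[OF j]] h] yoneda_map_inj[OF Dj[OF j]]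
      by metis
    show ?thesis
    proof (rule ex_ex1I)
      obtain \<sigma> where \<sigma>: "\<sigma> \<in> Hom ?P (representable C x) ?N"
        "\<forall>j\<in>Obj J. Comp ?P \<sigma> (\<tau> j) = ?k j" using uni by blast
      obtain h where "h \<in> Hom E (FObj F x) e" "\<sigma> = yoneda_map C E F x e h"
        using yoneda_map_surj[OF x e \<sigma>(1)] .
      then show "\<exists>h. h \<in> Hom E (FObj F x) e \<and> (\<forall>j\<in>Obj J. Comp E h (FArr F (\<iota> j)) = \<kappa> j)"
        using \<sigma>(2) iff by auto
    next
      fix h h'
      assume h: "h \<in> Hom E (FObj F x) e \<and> (\<forall>j\<in>Obj J. Comp E h (FArr F (\<iota> j)) = \<kappa> j)"
        and h': "h' \<in> Hom E (FObj F x) e \<and> (\<forall>j\<in>Obj J. Comp E h' (FArr F (\<iota> j)) = \<kappa> j)"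
      have "yoneda_map C E F x e h = yoneda_map C E F x e h'"
        using uni h h' iff yoneda_map_Hom[OF x] by metis
      then show "h = h'" using yoneda_map_inj[OF x] h h' by blast
    qed
  qed
  ultimately show ?thesis unfolding is_colimit_def by blast
qed

end

section \<open>Isomorphism invariance of colimits; absolute colimits\<close>

lemma is_colimit_isomorphic:
  assumes "category E" and "category J" and D: "is_functor J E D"
    and col: "is_colimit J E D x" and iso: "isomorphic E x y"
  shows "is_colimit J E D y"
proof -
  interpret E: category E by fact
  interpret J: category J by fact
  obtain f g where f: "f \<in> Hom E x y" and g: "g \<in> Hom E y x"
    and gf: "Comp E g f = Ide E x" and fg: "Comp E f g = Ide E y"
    using iso by (auto simp: isomorphic_def)
  obtain \<iota> where \<iota>: "is_cocone J E D x \<iota>"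
    and univ: "\<And>z \<kappa>. is_cocone J E D z \<kappa> \<Longrightarrow>
      \<exists>!h. h \<in> Hom E x z \<and> (\<forall>j\<in>Obj J. Comp E h (\<iota> j) = \<kappa> j)"
    using col unfolding is_colimit_def by blast
  note \<iota>j = cocone_Hom[OF \<iota>]
  have "is_cocone J E D y (\<lambda>j. Comp E f (\<iota> j))"
  proof (rule is_coconeI)
    show "y \<in> Obj E" using E.Hom_Obj[OF f] by simp
    show "Comp E f (\<iota> j) \<in> Hom E (FObj D j) y" if "j \<in> Obj J" for j
      using E.Comp_Hom[OF \<iota>j[OF that] f] .
    show "Comp E (Comp E f (\<iota> j)) (FArr D u) = Comp E f (\<iota> i)" if u: "u \<in> Hom J i j" for i j u
      using E.Comp_assoc[OF functor_Hom[OF D u] \<iota>j f] J.Hom_Obj[OF u] cocone_Comp[OF \<iota> u] by simp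
  qed
  moreover have "\<exists>!h. h \<in> Hom E y z \<and> (\<forall>j\<in>Obj J. Comp E h (Comp E f (\<iota> j)) = \<kappa> j)"
    if \<kappa>: "is_cocone J E D z \<kappa>" for z \<kappa>
  proof -
    obtain h where h: "h \<in> Hom E x z" "\<And>j. j \<in> Obj J \<Longrightarrow> Comp E h (\<iota> j) = \<kappa> j"
      and uni: "\<And>k. k \<in> Hom E x z \<Longrightarrow> \<forall>j\<in>Obj J. Comp E k (\<iota> j) = \<kappa> j \<Longrightarrow> k = h"
      using univ[OF \<kappa>] by blast
    show ?thesis
    \<comment> \<open>The arrow \<open>h\<close> induced on \<open>x\<close> is moved to
      \<open>y\<close> along the inverse \<open>g\<close> of \<open>f\<close>. Conversely, a
      solution \<open>k\<close> on \<open>y\<close> gives the solution \<open>Comp E k f\<close> on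
      \<open>x\<close>, which must be \<open>h\<close>.\<close>
    proof (rule ex1I[of _ "Comp E h g"], intro conjI ballI)
      show "Comp E h g \<in> Hom E y z" using E.Comp_Hom[OF g h(1)] .
      fix j assume j: "j \<in> Obj J"
      have "Comp E (Comp E h g) (Comp E f (\<iota> j)) = Comp E h (Comp E (Comp E g f) (\<iota> j))"
        using E.Comp_assoc[OF E.Comp_Hom[OF \<iota>j[OF j] f] g h(1)] E.Comp_assoc[OF \<iota>j[OF j] f g]
        by simp
      then show "Comp E (Comp E h g) (Comp E f (\<iota> j)) = \<kappa> j"
        using gf E.Comp_Ide_left[OF \<iota>j[OF j]] h(2)[OF j] by simp
    next
      fix k assume k: "k \<in> Hom E y z \<and> (\<forall>j\<in>Obj J. Comp E k (Comp E f (\<iota> j)) = \<kappa> j)"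
      have "\<forall>j\<in>Obj J. Comp E (Comp E k f) (\<iota> j) = \<kappa> j"
        using k E.Comp_assoc[OF \<iota>j f] by metis
      then have "Comp E k f = h" using uni E.Comp_Hom[OF f] k by blast
      then show "k = Comp E h g"
        using E.Comp_assoc[OF g f, of k z] fg E.Comp_Ide_right[of k y z] k by auto
    qed
  qed
  ultimately show ?thesis unfolding is_colimit_def by blast
qed

text \<open>No colimit of presheaves has to be constructed: a given image presheaf may be replaced
  by an isomorphic one, and conversely the representable itself serves as the image
  presheaf.\<close>

lemma absolute_colimit_iff:
  assumes "locally_small small C" and "category J" and D: "is_functor J C D" and X: "X \<in> Obj C"
  shows "absolute_colimit small C J D X \<longleftrightarrow>
    is_colimit J (presheaf_category small C) (functor_comp (yoneda C) D) (representable C X)"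
proof -
  interpret nerve_setting small C C id_functor
    using assms(1) by (simp add: nerve_setting_def nerve_setting_axioms_def id_functor_is_functor
        locally_small_def)
  interpret P: category "presheaf_category small C"
    by (rule category_presheaf_category[OF C.category_axioms])
  let ?P = "presheaf_category small C" and ?X = "representable C X"
  have "isomorphic ?P ?X ?X"
    using P.Ide_Hom[OF representable_Obj[OF X]] P.Comp_Ide_left unfolding isomorphic_def by blast
  then show ?thesis
    unfolding absolute_colimit_def is_image_presheaf_def
    using is_colimit_isomorphic[OF P.category_axioms \<open>category J\<close>
        functor_comp_is_functor[OF D yoneda_is_functor]] by blast
qed

section \<open>Split cocones\<close>

lemma equivclp_map:
  assumes "equivclp r x y" and "\<And>x y. r x y \<Longrightarrow> r' (f x) (f y)"
  shows "equivclp r' (f x) (f y)"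
  using assms(1)
proof (induction rule: equivclp_induct)
  case (step y z)
  then show ?case
    using assms(2) by (meson equivclp_into_equivclp)
qed simp

text \<open>\<open>Base\<close> wraps an arrow of \<open>C\<close>, \<open>Elem\<close> holds a
  representative of a component of some \<open>z/D\<close>, and \<open>Apex\<close> is the identity
  of the adjoined object.\<close>

datatype ('i, 'a) collage_arr = Base 'a | Elem "'i \<times> 'a" | Apex

locale diagram = J: category J + C: category C
  for J :: "('i, 'k) cat" and C :: "('o, 'a) cat" +
  fixes D :: "('i, 'k, 'o, 'a) func"
  assumes D: "is_functor J C D"
begin

abbreviation elements :: "'o \<Rightarrow> ('i \<times> 'a) set" where
  "elements z \<equiv> Obj (comma J C z D)"

text \<open>The quotient of \<open>elements z\<close> by this relation is the pointwise formula for
  the image presheaf of \<open>D\<close> at \<open>z\<close>.\<close>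

abbreviation conn :: "'o \<Rightarrow> 'i \<times> 'a \<Rightarrow> 'i \<times> 'a \<Rightarrow> bool" where
  "conn z \<equiv> equivclp (\<lambda>s t. Hom (comma J C z D) s t \<noteq> {})"

text \<open>The elementary form of an isomorphism from the image presheaf to the representable on
  \<open>X\<close>. One direction is \<open>\<iota>\<close>; by Yoneda the inverse is a component of
  \<open>X/D\<close>, represented by \<open>(i, s)\<close>. The last two conditions say that both
  composites are identities.\<close>

definition split_cocone :: "'o \<Rightarrow> ('i \<Rightarrow> 'a) \<Rightarrow> 'i \<Rightarrow> 'a \<Rightarrow> bool" where
  "split_cocone X \<iota> i s \<longleftrightarrow> is_cocone J C D X \<iota> \<and> i \<in> Obj J \<and> s \<in> Hom C X (FObj D i) \<and>
     Comp C (\<iota> i) s = Ide C X \<and>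
     (\<forall>j\<in>Obj J. conn (FObj D j) (i, Comp C s (\<iota> j)) (j, Ide C (FObj D j)))"

lemma elements_iff: "(j, f) \<in> elements z \<longleftrightarrow> j \<in> Obj J \<and> f \<in> Hom C z (FObj D j)"
  by (simp add: Obj_comma)

text \<open>\<open>equivclp\<close> is reflexive outside the comma category too, but arrows join
  only its objects, so membership is an invariant.\<close>

lemma conn_elements: "conn z s t \<Longrightarrow> s \<in> elements z \<longleftrightarrow> t \<in> elements z"
  by (erule equivclp_invariant[where f = "\<lambda>s. s \<in> elements z"]) (auto simp: Hom_comma_iff)

text \<open>Precomposition with \<open>h\<close> is a functor from \<open>z/D\<close> to
  \<open>w/D\<close>, as the same \<open>u\<close> connects the images. Hence the components form a
  presheaf.\<close>

lemma conn_precompose: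
  assumes "conn z s t" and h: "h \<in> Hom C w z"
  shows "conn w (fst s, Comp C (snd s) h) (fst t, Comp C (snd t) h)"
proof (rule equivclp_map[OF assms(1), where f = "\<lambda>s. (fst s, Comp C (snd s) h)"])
  fix s t assume "Hom (comma J C z D) s t \<noteq> {}"
  then obtain u where st: "s \<in> elements z" "t \<in> elements z"
    and u: "u \<in> Hom J (fst s) (fst t)" "Comp C (FArr D u) (snd s) = snd t"
    unfolding Hom_comma_iff by auto
  have s: "snd s \<in> Hom C z (FObj D (fst s))" and t: "snd t \<in> Hom C z (FObj D (fst t))"
    using st by (auto simp: Obj_comma)
  have "Comp C (FArr D u) (Comp C (snd s) h) = Comp C (snd t) h"
    using C.Comp_assoc[OF h s functor_Hom[OF D u(1)]] u(2) by simp
  then show "Hom (comma J C w D) (fst s, Comp C (snd s) h) (fst t, Comp C (snd t) h) \<noteq> {}"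
    using st u(1) C.Comp_Hom[OF h s] C.Comp_Hom[OF h t]
    unfolding Hom_comma_iff by (auto simp: Obj_comma)
qed

text \<open>Here \<open>u\<close> itself is the connecting arrow. This makes the components of the
  identities a cocone under \<open>D\<close>.\<close>

lemma conn_arrow:
  assumes u: "u \<in> Hom J i j"
  shows "conn (FObj D i) (i, Ide C (FObj D i)) (j, FArr D u)"
proof -
  have i: "i \<in> Obj J" and j: "j \<in> Obj J" using J.Hom_Obj[OF u] by auto
  have "Hom (comma J C (FObj D i) D) (i, Ide C (FObj D i)) (j, FArr D u) \<noteq> {}"
    using u i j C.Ide_Hom[OF functor_Obj[OF D i]] functor_Hom[OF D u]
      C.Comp_Ide_right[OF functor_Hom[OF D u]]
    by (auto simp: Hom_comma_iff elements_iff)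
  then show ?thesis by (rule r_into_equivclp)
qed

text \<open>Representatives in place of equivalence classes keep the arrows of the collage free of
  sets, so that they can be coded by elements of \<open>'v\<close>.\<close>

definition canon :: "'o \<Rightarrow> 'i \<times> 'a \<Rightarrow> 'i \<times> 'a" where
  "canon z s = (SOME t. conn z s t)"

lemma conn_canon: "conn z s (canon z s)"
  unfolding canon_def by (rule someI[of _ s]) simp

lemma canon_eq_iff: "canon z s = canon z t \<longleftrightarrow> conn z s t"
proof
  assume "canon z s = canon z t"
  with conn_canon[of z s] have "conn z s (canon z t)" by simp
  then show "conn z s t"
    by (rule equivclp_trans[OF _ equivclp_sym[OF conn_canon]])
next
  assume "conn z s t"
  \<comment> \<open>Connected pairs define the same predicate, so \<open>SOME\<close> picks the same
    representative.\<close>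
  then have "conn z s = conn z t"
    by (intro ext iffI) (auto intro: equivclp_trans[OF equivclp_sym] equivclp_trans)
  then show "canon z s = canon z t" by (simp add: canon_def)
qed

lemma canon_elements: "s \<in> elements z \<Longrightarrow> canon z s \<in> elements z"
  using conn_elements[OF conn_canon] by blast

text \<open>
  The category \<open>C\<close> with a new object \<open>None\<close> adjoined, such that the arrows from \<open>z\<close> to \<open>None\<close>
  are the connected components of \<open>z/D\<close>, given by chosen representatives.
\<close>

definition collage :: "('o option, ('i, 'a) collage_arr) cat" where
  "collage =
     \<lparr>Obj = insert None (Some ` Obj C),
      Arr = Base ` Arr C \<union> (\<Union>z\<in>Obj C. Elem ` canon z ` elements z) \<union> {Apex},
      Dom = (\<lambda>f. case f of Base f \<Rightarrow> Some (Dom C f) | Elem s \<Rightarrow> Some (Dom C (snd s)) | Apex \<Rightarrow> None),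
      Cod = (\<lambda>f. case f of Base f \<Rightarrow> Some (Cod C f) | _ \<Rightarrow> None),
      Ide = (\<lambda>x. case x of Some x \<Rightarrow> Base (Ide C x) | None \<Rightarrow> Apex),
      Comp = (\<lambda>g f. case f of
          Base f \<Rightarrow> (case g of
              Base g \<Rightarrow> Base (Comp C g f)
            | Elem s \<Rightarrow> Elem (canon (Dom C f) (fst s, Comp C (snd s) f))
            | Apex \<Rightarrow> Apex)
        | _ \<Rightarrow> f)\<rparr>"

lemma collage_simps [simp]:
  "Obj collage = insert None (Some ` Obj C)"
  "Ide collage (Some x) = Base (Ide C x)" "Ide collage None = Apex"
  "Comp collage (Base g) (Base f) = Base (Comp C g f)"
  "Comp collage k Apex = Apex" "Comp collage k (Elem s) = Elem s"
  by (simp_all add: collage_def)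

text \<open>An arrow \<open>Elem s\<close> records its source only as \<open>Dom C (snd s)\<close>;
  the chosen representative keeps it because it stays in \<open>elements z\<close>.\<close>

lemma Dom_canon: "s \<in> elements z \<Longrightarrow> Dom C (snd (canon z s)) = z"
  using canon_elements[of s z] by (auto simp: Obj_comma Hom_def)

lemma Hom_collage:
  "Hom collage (Some x) (Some y) = Base ` Hom C x y"
  "z \<in> Obj C \<Longrightarrow> Hom collage (Some z) None = Elem ` canon z ` elements z"
  "Hom collage None None = {Apex}"
  "Hom collage None (Some y) = {}"
proof -
  show "Hom collage (Some z) None = Elem ` canon z ` elements z" if "z \<in> Obj C"
  proof (intro equalityI subsetI)
    fix f assume "f \<in> Hom collage (Some z) None"
    then have "(\<exists>y s. s \<in> elements y \<and> f = Elem (canon y s)) \<and> Dom collage f = Some z"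
      unfolding Hom_def collage_def by auto
    then obtain y s where s: "s \<in> elements y" and f: "f = Elem (canon y s)"
      and "Dom collage f = Some z" by blast
    then have "y = z" using Dom_canon[OF s] by (simp add: collage_def)
    then show "f \<in> Elem ` canon z ` elements z" using s f by simp
  next
    fix f assume "f \<in> Elem ` canon z ` elements z"
    then obtain s where s: "s \<in> elements z" and f: "f = Elem (canon z s)" by blast
    then show "f \<in> Hom collage (Some z) None"
      using that Dom_canon[OF s] unfolding Hom_def collage_def by auto
  qed
qed (auto simp: Hom_def collage_def)

text \<open>Composition in \<open>collage\<close> uses the stored representative; by
  \<open>conn_precompose\<close> any other member of the component gives the same result.\<close>

lemma Comp_Elem_Base:
  assumes s: "s \<in> elements y" and f: "f \<in> Hom C x y"
  shows "Comp collage (Elem (canon y s)) (Base f) = Elem (canon x (fst s, Comp C (snd s) f))"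
proof -
  have "conn x (fst (canon y s), Comp C (snd (canon y s)) f) (fst s, Comp C (snd s) f)"
    by (rule conn_precompose[OF equivclp_sym[OF conn_canon] f])
  then show ?thesis
    by (simp add: collage_def Hom_Arr[OF f] canon_eq_iff)
qed

lemma elements_precompose:
  "s \<in> elements y \<Longrightarrow> f \<in> Hom C x y \<Longrightarrow> (fst s, Comp C (snd s) f) \<in> elements x"
  using C.Comp_Hom by (auto simp: Obj_comma)

lemma Dom_collage: "f \<in> Arr collage \<Longrightarrow> Dom collage f \<in> Obj collage"
  using C.Dom_Obj Dom_canon by (auto simp: collage_def)

lemma Hom_collageE:
  assumes "f \<in> Hom collage a b"
  obtains (base) x y f' where "a = Some x" "b = Some y" "f' \<in> Hom C x y" "f = Base f'"
  | (elem) z s where "a = Some z" "b = None" "z \<in> Obj C" "s \<in> elements z" "f = Elem (canon z s)"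
  | (apex) "a = None" "b = None" "f = Apex"
proof -
  have "a = None \<or> (\<exists>x\<in>Obj C. a = Some x)"
    using Dom_collage[of f] assms by (auto simp: Hom_Arr)
  then show thesis
    using assms that by (cases b) (auto simp: Hom_collage)
qed

lemma category_collage: "category collage"
proof
  show "Dom collage f \<in> Obj collage" "Cod collage f \<in> Obj collage" if "f \<in> Arr collage" for f
    using that Dom_collage C.Cod_Obj by (auto simp: collage_def)
  show "Ide collage a \<in> Hom collage a a" if "a \<in> Obj collage" for a
    using that C.Ide_Hom by (auto simp: Hom_collage)
  show "Comp collage g f \<in> Hom collage a c"
    if f: "f \<in> Hom collage a b" and g: "g \<in> Hom collage b c" for f g a b c
    using f
  proof (cases rule: Hom_collageE)
    case (base x y f')
    note b = this
    show ?thesis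
      using g
    proof (cases rule: Hom_collageE)
      case base
      then show ?thesis using b C.Comp_Hom by (auto simp: Hom_collage)
    next
      case (elem z s)
      then have "f' \<in> Hom C x z" "x \<in> Obj C" using b C.Hom_Obj by auto
      then show ?thesis
        using b elem elements_precompose by (auto simp: Hom_collage Comp_Elem_Base)
    qed (use b in auto)
  qed (use g in \<open>auto elim!: Hom_collageE simp: Hom_collage\<close>)
  show "Comp collage f (Ide collage a) = f" if "f \<in> Hom collage a b" for f a b
    using that
  proof (cases rule: Hom_collageE)
    case (elem z s)
    then have "Comp C (snd s) (Ide C z) = snd s"
      using C.Comp_Ide_right by (auto simp: Obj_comma)
    then show ?thesis
      using Comp_Elem_Base[OF elem(4) C.Ide_Hom[OF elem(3)]] elem by simp
  qed (auto intro: C.Comp_Ide_right)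
  show "Comp collage (Ide collage b) f = f" if "f \<in> Hom collage a b" for f a b
    using that by (cases rule: Hom_collageE) (auto intro: C.Comp_Ide_left)
  show "Comp collage h (Comp collage g f) = Comp collage (Comp collage h g) f"
    if f: "f \<in> Hom collage a b" and g: "g \<in> Hom collage b c" and h: "h \<in> Hom collage c d"
    for f g h a b c d
    using f
  proof (cases rule: Hom_collageE)
    case (base x y f')
    note f' = this
    show ?thesis
      using g
    proof (cases rule: Hom_collageE)
      case (base y' z g')
      then have g': "c = Some z" "g' \<in> Hom C y z" "g = Base g'" using f' by auto
      show ?thesis
        using h
      proof (cases rule: Hom_collageE)
        case base
        then show ?thesis using f' g' C.Comp_assoc[OF f'(3) g'(2)] by simp
      next
        case (elem z' s)
        then have s: "s \<in> elements z" "h = Elem (canon z s)" using g' by auto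
        then have "snd s \<in> Hom C z (FObj D (fst s))" by (auto simp: Obj_comma)
        then show ?thesis
          using s f' g' C.Comp_Hom[OF f'(3) g'(2)] elements_precompose[OF s(1) g'(2)]
            C.Comp_assoc[OF f'(3) g'(2)]
          by (simp add: Comp_Elem_Base)
      qed (use g' in auto)
    next
      case (elem y' s)
      then have s: "s \<in> elements y" and "c = None" using f' by auto
      \<comment> \<open>The adjoined object has no outgoing arrow besides its identity.\<close>
      then have "h = Apex" using h by (cases d) (auto simp: Hom_collage)
      moreover have "Comp collage Apex (Elem t) = Elem t" "Comp collage Apex (Base k) = Apex" for t k
        by (simp_all add: collage_def)
      ultimately show ?thesis using elem f' Comp_Elem_Base[OF s f'(3)] by simp
    qed (use f' in auto)
  qed simp_all
qed

definition collage_inclusion :: "('o, 'a, 'o option, ('i, 'a) collage_arr) func" where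
  "collage_inclusion = \<lparr>FObj = Some, FArr = Base\<rparr>"

lemma collage_inclusion_simps [simp]:
  "FObj collage_inclusion x = Some x" "FArr collage_inclusion f = Base f"
  by (simp_all add: collage_inclusion_def)

lemma collage_inclusion_is_functor: "is_functor C collage collage_inclusion"
  by (rule is_functorI) (auto simp: Hom_collage)

text \<open>The universal property is applied to two cocones. The components of the identities, with
  vertex \<open>None\<close>, produce \<open>s\<close>; the colimit cocone itself shows, by
  uniqueness, that \<open>s\<close> is a section of \<open>\<iota> i\<close>.\<close>

lemma split_cocone_if_colimit:
  assumes X: "X \<in> Obj C"
    and col: "is_colimit J collage (functor_comp collage_inclusion D) (Some X)"
  obtains \<iota> i s where "split_cocone X \<iota> i s"
proof -
  let ?D = "functor_comp collage_inclusion D"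
  obtain \<iota>' where \<iota>': "is_cocone J collage ?D (Some X) \<iota>'"
    and univ: "\<And>y \<kappa>. is_cocone J collage ?D y \<kappa> \<Longrightarrow>
      \<exists>!h. h \<in> Hom collage (Some X) y \<and> (\<forall>j\<in>Obj J. Comp collage h (\<iota>' j) = \<kappa> j)"
    using col unfolding is_colimit_def by blast
  note Dj = functor_Obj[OF D]
  \<comment> \<open>The inclusion of \<open>C\<close> into the collage is full.\<close>
  have "\<exists>k. k \<in> Hom C (FObj D j) X \<and> \<iota>' j = Base k" if "j \<in> Obj J" for j
    using cocone_Hom[OF \<iota>' that] by (auto simp: Hom_collage)
  then obtain \<iota> where \<iota>: "\<And>j. j \<in> Obj J \<Longrightarrow> \<iota> j \<in> Hom C (FObj D j) X"
    and \<iota>'_eq: "\<And>j. j \<in> Obj J \<Longrightarrow> \<iota>' j = Base (\<iota> j)" by metis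
  have cocone: "is_cocone J C D X \<iota>"
  proof (rule is_coconeI)
    show "Comp C (\<iota> j) (FArr D u) = \<iota> i" if u: "u \<in> Hom J i j" for i j u
      using cocone_Comp[OF \<iota>' u] J.Hom_Obj[OF u] \<iota>'_eq by simp
  qed (use X \<iota> in auto)
  let ?\<kappa> = "\<lambda>j. Elem (canon (FObj D j) (j, Ide C (FObj D j)))"
  have ide: "(j, Ide C (FObj D j)) \<in> elements (FObj D j)" if "j \<in> Obj J" for j
    using that C.Ide_Hom[OF Dj[OF that]] by (simp add: elements_iff)
  have "is_cocone J collage ?D None ?\<kappa>"
  proof (rule is_coconeI)
    show "?\<kappa> j \<in> Hom collage (FObj ?D j) None" if "j \<in> Obj J" for j
      using ide[OF that] Dj[OF that] by (simp add: Hom_collage)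
    show "Comp collage (?\<kappa> j) (FArr ?D u) = ?\<kappa> i" if u: "u \<in> Hom J i j" for i j u
    proof -
      have "j \<in> Obj J" using J.Hom_Obj[OF u] by simp
      then show ?thesis
        using Comp_Elem_Base[OF ide functor_Hom[OF D u]] C.Comp_Ide_left[OF functor_Hom[OF D u]]
          equivclp_sym[OF conn_arrow[OF u]]
        by (simp add: canon_eq_iff)
    qed
  qed simp
  from univ[OF this] obtain h where "h \<in> Hom collage (Some X) None"
    and h: "\<And>j. j \<in> Obj J \<Longrightarrow> Comp collage h (\<iota>' j) = ?\<kappa> j" by blast
  then obtain i s where ij: "(i, s) \<in> elements X" and h_eq: "h = Elem (canon X (i, s))"
    using X by (auto simp: Hom_collage)
  have i: "i \<in> Obj J" and s: "s \<in> Hom C X (FObj D i)" using ij by (auto simp: elements_iff)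
  \<comment> \<open>Both sides of the cocone equation for \<open>h\<close> are representatives of
    components of \<open>D j/D\<close>, so their equality says that the two pairs are
    connected.\<close>
  have conn: "conn (FObj D j) (i, Comp C s (\<iota> j)) (j, Ide C (FObj D j))" if j: "j \<in> Obj J" for j
    using h[OF j] Comp_Elem_Base[OF ij \<iota>[OF j]] by (simp add: h_eq \<iota>'_eq[OF j] canon_eq_iff)
  let ?e = "Comp C (\<iota> i) s"
  have e: "?e \<in> Hom C X X" using C.Comp_Hom[OF s \<iota>[OF i]] .
  have cocone_id: "is_cocone J C (functor_comp id_functor D) X \<iota>"
    using cocone by (simp add: is_cocone_def)
  \<comment> \<open>Composition with the legs of \<open>\<iota>\<close> is constant on the component
    that contains \<open>(i, Comp C s (\<iota> j))\<close> and the identity of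
    \<open>D j\<close>.\<close>
  have "Comp C ?e (\<iota> j) = \<iota> j" if j: "j \<in> Obj J" for j
    using cocone_component_eq[OF C.category_axioms D id_functor_is_functor cocone_id conn[OF j]]
      C.Comp_assoc[OF \<iota>[OF j] s \<iota>[OF i]] C.Comp_Ide_right[OF \<iota>[OF j]] by simp
  then have "Base ?e \<in> Hom collage (Some X) (Some X) \<and>
      (\<forall>j\<in>Obj J. Comp collage (Base ?e) (\<iota>' j) = \<iota>' j)"
    using e \<iota>'_eq by (simp add: Hom_collage)
  moreover have "Base (Ide C X) \<in> Hom collage (Some X) (Some X) \<and>
      (\<forall>j\<in>Obj J. Comp collage (Base (Ide C X)) (\<iota>' j) = \<iota>' j)"
    using C.Ide_Hom[OF X] \<iota>'_eq C.Comp_Ide_left[OF \<iota>] by (simp add: Hom_collage)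
  ultimately have "?e = Ide C X" using univ[OF \<iota>'] by blast
  then have "split_cocone X \<iota> i s"
    using cocone i s conn by (simp add: split_cocone_def)
  then show thesis by (rule that)
qed

end

section \<open>Relabelling objects and arrows\<close>

text \<open>Condition (2) speaks of categories with objects and arrows in \<open>'v\<close>, so the
  collage is transported there along injections; \<open>inv\<close> decodes.\<close>

definition relabel :: "('o \<Rightarrow> 'p) \<Rightarrow> ('a \<Rightarrow> 'b) \<Rightarrow> ('o, 'a) cat \<Rightarrow> ('p, 'b) cat" where
  "relabel p q E = \<lparr>Obj = p ` Obj E, Arr = q ` Arr E, Dom = (\<lambda>f. p (Dom E (inv q f))),
     Cod = (\<lambda>f. p (Cod E (inv q f))), Ide = (\<lambda>x. q (Ide E (inv p x))),
     Comp = (\<lambda>g f. q (Comp E (inv q g) (inv q f)))\<rparr>"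

locale relabelling = category E for E :: "('o, 'a) cat" +
  fixes p :: "'o \<Rightarrow> 'p" and q :: "'a \<Rightarrow> 'b"
  assumes inj_p: "inj p" and inj_q: "inj q"
begin

lemma relabel_simps [simp]:
  "Obj (relabel p q E) = p ` Obj E"
  "Ide (relabel p q E) (p x) = q (Ide E x)"
  "Comp (relabel p q E) (q g) (q f) = q (Comp E g f)"
  by (simp_all add: relabel_def inj_p inj_q)

lemma Hom_relabel: "Hom (relabel p q E) (p x) (p y) = q ` Hom E x y"
  by (auto simp: Hom_def relabel_def inj_p inj_q inj_eq)

lemma Hom_relabelE:
  assumes "f \<in> Hom (relabel p q E) a b"
  obtains x y g where "a = p x" "b = p y" "g \<in> Hom E x y" "f = q g"
  using assms by (auto simp: Hom_def relabel_def inj_q)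

lemma category_relabel: "category (relabel p q E)"
proof
  show "Dom (relabel p q E) f \<in> Obj (relabel p q E)" "Cod (relabel p q E) f \<in> Obj (relabel p q E)"
    if "f \<in> Arr (relabel p q E)" for f
    using that Dom_Obj Cod_Obj by (auto simp: relabel_def inj_q)
  show "Ide (relabel p q E) a \<in> Hom (relabel p q E) a a" if "a \<in> Obj (relabel p q E)" for a
    using that Ide_Hom by (auto simp: Hom_relabel)
  show "Comp (relabel p q E) g f \<in> Hom (relabel p q E) a c"
    if "f \<in> Hom (relabel p q E) a b" "g \<in> Hom (relabel p q E) b c" for f g a b c
    using that Comp_Hom by (auto elim!: Hom_relabelE simp: Hom_relabel inj_p inj_eq)
  show "Comp (relabel p q E) f (Ide (relabel p q E) a) = f"
    if "f \<in> Hom (relabel p q E) a b" for f a b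
    using that Comp_Ide_right by (auto elim!: Hom_relabelE)
  show "Comp (relabel p q E) (Ide (relabel p q E) b) f = f"
    if "f \<in> Hom (relabel p q E) a b" for f a b
    using that Comp_Ide_left by (auto elim!: Hom_relabelE)
  show "Comp (relabel p q E) h (Comp (relabel p q E) g f) =
      Comp (relabel p q E) (Comp (relabel p q E) h g) f"
    if "f \<in> Hom (relabel p q E) a b" "g \<in> Hom (relabel p q E) b c" "h \<in> Hom (relabel p q E) c d"
    for f g h a b c d
    using that by (elim Hom_relabelE) (simp add: inj_p inj_eq Comp_assoc)
qed

definition relabel_functor :: "('o, 'a, 'p, 'b) func" where
  "relabel_functor = \<lparr>FObj = p, FArr = q\<rparr>"

lemma relabel_functor_simps [simp]:
  "FObj relabel_functor x = p x" "FArr relabel_functor f = q f"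
  by (simp_all add: relabel_functor_def)

lemma relabel_functor_is_functor: "is_functor E (relabel p q E) relabel_functor"
  by (rule is_functorI) (auto simp: Hom_relabel)

text \<open>A cocone in \<open>E\<close> has an image in the relabelled category, whose comparison
  arrow is some \<open>q h\<close>. Injectivity of \<open>q\<close> carries the equations and
  uniqueness back to \<open>E\<close>.\<close>

lemma is_colimit_relabel:
  assumes J: "category J" and G: "is_functor J E G" and x: "x \<in> Obj E"
    and col: "is_colimit J (relabel p q E) (functor_comp relabel_functor G) (p x)"
  shows "is_colimit J E G x"
proof -
  let ?E = "relabel p q E" and ?G = "functor_comp relabel_functor G"
  obtain \<iota>' where \<iota>': "is_cocone J ?E ?G (p x) \<iota>'"
    and univ: "\<And>y \<kappa>. is_cocone J ?E ?G y \<kappa> \<Longrightarrow>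
      \<exists>!h. h \<in> Hom ?E (p x) y \<and> (\<forall>j\<in>Obj J. Comp ?E h (\<iota>' j) = \<kappa> j)"
    using col unfolding is_colimit_def by blast
  have "\<exists>k. k \<in> Hom E (FObj G j) x \<and> \<iota>' j = q k" if "j \<in> Obj J" for j
    using cocone_Hom[OF \<iota>' that] by (auto simp: Hom_relabel)
  then obtain \<iota> where \<iota>: "\<And>j. j \<in> Obj J \<Longrightarrow> \<iota> j \<in> Hom E (FObj G j) x"
    and \<iota>'_eq: "\<And>j. j \<in> Obj J \<Longrightarrow> \<iota>' j = q (\<iota> j)" by metis
  have "is_cocone J E G x \<iota>"
  proof (rule is_coconeI)
    show "Comp E (\<iota> j) (FArr G u) = \<iota> i" if u: "u \<in> Hom J i j" for i j u
      using cocone_Comp[OF \<iota>' u] category.Hom_Obj[OF J u] \<iota>'_eq by (simp add: inj_q inj_eq)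
  qed (use x \<iota> in auto)
  moreover have "\<exists>!h. h \<in> Hom E x y \<and> (\<forall>j\<in>Obj J. Comp E h (\<iota> j) = \<kappa> j)"
    if \<kappa>: "is_cocone J E G y \<kappa>" for y \<kappa>
  proof -
    have "is_cocone J ?E ?G (p y) (\<lambda>j. q (\<kappa> j))"
      using is_cocone_functor[OF J relabel_functor_is_functor G \<kappa>] by simp
    then have uni: "\<exists>!h. h \<in> Hom ?E (p x) (p y) \<and> (\<forall>j\<in>Obj J. Comp ?E h (\<iota>' j) = q (\<kappa> j))"
      by (rule univ)
    have iff: "q h \<in> Hom ?E (p x) (p y) \<and> (\<forall>j\<in>Obj J. Comp ?E (q h) (\<iota>' j) = q (\<kappa> j)) \<longleftrightarrow>
        h \<in> Hom E x y \<and> (\<forall>j\<in>Obj J. Comp E h (\<iota> j) = \<kappa> j)" for h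
      using \<iota>'_eq by (auto simp: Hom_relabel inj_q inj_eq)
    obtain h where "q h \<in> Hom ?E (p x) (p y) \<and> (\<forall>j\<in>Obj J. Comp ?E (q h) (\<iota>' j) = q (\<kappa> j))"
      using uni by (auto simp: Hom_relabel)
    then show ?thesis
      using uni iff inj_q by (intro ex_ex1I) (blast, metis injD)
  qed
  ultimately show ?thesis unfolding is_colimit_def by blast
qed

end

section \<open>Small slices\<close>

text \<open>
  The full subcategory of \<open>C/X\<close> on the arrows with domain in \<open>S\<close>, where \<open>e\<close> is an injective
  pairing. The arrow \<open>e (g, u)\<close> is \<open>u\<close>, seen as an arrow from \<open>g u\<close> to \<open>g\<close>.
\<close>

definition slice :: "('a \<times> 'a \<Rightarrow> 'b) \<Rightarrow> ('o, 'a) cat \<Rightarrow> 'o \<Rightarrow> 'o set \<Rightarrow> ('a, 'b) cat" where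
  "slice e C X S =
     \<lparr>Obj = {f \<in> Arr C. Cod C f = X \<and> Dom C f \<in> S},
      Arr = e ` {(g, u). g \<in> Arr C \<and> Cod C g = X \<and> Dom C g \<in> S \<and>
                         u \<in> Arr C \<and> Cod C u = Dom C g \<and> Dom C u \<in> S},
      Dom = (\<lambda>a. Comp C (fst (inv e a)) (snd (inv e a))),
      Cod = (\<lambda>a. fst (inv e a)),
      Ide = (\<lambda>f. e (f, Ide C (Dom C f))),
      Comp = (\<lambda>b a. e (fst (inv e b), Comp C (snd (inv e b)) (snd (inv e a))))\<rparr>"

definition slice_projection :: "('a \<times> 'a \<Rightarrow> 'b) \<Rightarrow> ('o, 'a) cat \<Rightarrow> ('a, 'b, 'o, 'a) func" where
  "slice_projection e C = \<lparr>FObj = Dom C, FArr = (\<lambda>a. snd (inv e a))\<rparr>"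

locale slice_category = category C for C :: "('o, 'a) cat" +
  fixes e :: "'a \<times> 'a \<Rightarrow> 'b" and X :: 'o and S :: "'o set"
  assumes inj_e: "inj e"
begin

abbreviation "SL \<equiv> slice e C X S"

lemma Obj_slice: "f \<in> Obj SL \<longleftrightarrow> f \<in> Hom C (Dom C f) X \<and> Dom C f \<in> S"
  by (auto simp: slice_def Hom_def)

lemma slice_simps [simp]:
  "Ide SL f = e (f, Ide C (Dom C f))"
  "Comp SL (e (h, v)) (e (g, u)) = e (h, Comp C v u)"
  by (simp_all add: slice_def inj_e)

lemma slice_projection_simps [simp]:
  "FObj (slice_projection e C) f = Dom C f"
  "FArr (slice_projection e C) (e (g, u)) = u"
  by (simp_all add: slice_projection_def inj_e)

lemma Hom_sliceI:
  assumes "f \<in> Obj SL" "g \<in> Obj SL" "u \<in> Hom C (Dom C f) (Dom C g)" "Comp C g u = f"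
  shows "e (g, u) \<in> Hom SL f g"
  using assms by (auto simp: slice_def Hom_def inj_e)

text \<open>The code does not store the source \<open>f\<close>; it is recovered as
  \<open>Comp C g u\<close>, whose domain is that of \<open>u\<close>.\<close>

lemma Hom_sliceE:
  assumes "a \<in> Hom SL f g"
  obtains u where "a = e (g, u)" "u \<in> Hom C (Dom C f) (Dom C g)" "Comp C g u = f"
    "f \<in> Obj SL" "g \<in> Obj SL"
proof -
  obtain u where a: "a = e (g, u)" and g: "g \<in> Obj SL" and u: "u \<in> Hom C (Dom C u) (Dom C g)"
    and f: "Comp C g u = f" and "Dom C u \<in> S"
    using assms by (auto simp: slice_def Hom_def inj_e)
  have "f \<in> Hom C (Dom C u) X"
    using Comp_Hom[OF u] g f by (auto simp: Obj_slice)
  then have "Dom C f = Dom C u" "f \<in> Obj SL"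
    using \<open>Dom C u \<in> S\<close> by (simp_all add: Obj_slice Hom_Arr)
  then show thesis using that a u f g by simp
qed

lemma category_slice: "category SL"
proof
  have *: "Dom SL a \<in> Obj SL \<and> Cod SL a \<in> Obj SL" if a: "a \<in> Arr SL" for a
    using Hom_sliceE[OF Arr_Hom[OF a]] by metis
  show "Dom SL a \<in> Obj SL" "Cod SL a \<in> Obj SL" if "a \<in> Arr SL" for a
    using *[OF that] by auto
  show "Ide SL f \<in> Hom SL f f" if f: "f \<in> Obj SL" for f
  proof -
    have f': "f \<in> Hom C (Dom C f) X" using f by (simp add: Obj_slice)
    show ?thesis
      using Hom_sliceI[OF f f Ide_Hom[OF Hom_Obj(1)[OF f']] Comp_Ide_right[OF f']] by simp
  qed
  show "Comp SL b a \<in> Hom SL f h" if a: "a \<in> Hom SL f g" and b: "b \<in> Hom SL g h" for a b f g h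
  proof -
    obtain u where u: "a = e (g, u)" "u \<in> Hom C (Dom C f) (Dom C g)" "Comp C g u = f" "f \<in> Obj SL"
      using a by (rule Hom_sliceE)
    obtain v where v: "b = e (h, v)" "v \<in> Hom C (Dom C g) (Dom C h)" "Comp C h v = g" "h \<in> Obj SL"
      using b by (rule Hom_sliceE)
    have "h \<in> Hom C (Dom C h) X" using v(4) by (simp add: Obj_slice)
    then have "Comp C h (Comp C v u) = f"
      using Comp_assoc[OF u(2) v(2)] u(3) v(3) by simp
    then show ?thesis
      using Hom_sliceI[OF u(4) v(4) Comp_Hom[OF u(2) v(2)]] u(1) v(1) by simp
  qed
  show "Comp SL a (Ide SL f) = a" if a: "a \<in> Hom SL f g" for a f g
    using a by (rule Hom_sliceE) (simp add: Comp_Ide_right)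
  show "Comp SL (Ide SL g) a = a" if a: "a \<in> Hom SL f g" for a f g
    using a by (rule Hom_sliceE) (simp add: Comp_Ide_left)
  show "Comp SL c (Comp SL b a) = Comp SL (Comp SL c b) a"
    if "a \<in> Hom SL f g" "b \<in> Hom SL g h" "c \<in> Hom SL h k" for a b c f g h k
    using that by (elim Hom_sliceE) (simp add: Comp_assoc)
qed

lemma slice_projection_is_functor: "is_functor SL C (slice_projection e C)"
proof (rule is_functorI)
  show "FObj (slice_projection e C) f \<in> Obj C" if "f \<in> Obj SL" for f
    using that Hom_Obj by (auto simp: Obj_slice)
qed (auto elim!: Hom_sliceE)

text \<open>The identity of \<open>X\<close> lies in the slice because \<open>X \<in> S\<close>, and
  it is terminal there. So each comma category has a single object, given by \<open>f\<close> as an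
  arrow to the identity.\<close>

lemma confinal_terminal_slice:
  assumes X: "X \<in> Obj C" and XS: "X \<in> S"
  shows "confinal (terminal_cat :: ('i, 'k) cat) SL (object_functor SL (Ide C X))"
    and "functor_eq terminal_cat
      (functor_comp (slice_projection e C) (object_functor SL (Ide C X))) (object_functor C X)"
proof -
  have id: "Dom C (Ide C X) = X" "Ide C X \<in> Hom C X X" using Ide_Hom[OF X] by (simp_all add: Hom_Arr)
  then have i: "Ide C X \<in> Obj SL" using XS by (simp add: Obj_slice)
  show "functor_eq terminal_cat
      (functor_comp (slice_projection e C) (object_functor SL (Ide C X))) (object_functor C X)"
    using id by (simp add: functor_eq_def object_functor_def terminal_cat_def)
  let ?T = "terminal_cat :: ('i, 'k) cat"
  show "confinal ?T SL (object_functor SL (Ide C X))"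
    unfolding confinal_def
  proof (intro conjI ballI)
    show "is_functor ?T SL (object_functor SL (Ide C X))"
      by (rule is_functor_terminal[OF category_slice i])
    fix f assume f: "f \<in> Obj SL"
    then have f': "f \<in> Hom C (Dom C f) X" by (simp add: Obj_slice)
    have "Hom SL f (Ide C X) = {e (Ide C X, f)}"
    proof (intro equalityI subsetI)
      fix a assume "a \<in> Hom SL f (Ide C X)"
      then show "a \<in> {e (Ide C X, f)}"
        using Comp_Ide_left by (elim Hom_sliceE) (simp add: id)
    next
      fix a assume "a \<in> {e (Ide C X, f)}"
      then show "a \<in> Hom SL f (Ide C X)"
        using Hom_sliceI[OF f i] f' Comp_Ide_left[OF f'] by (simp add: id)
    qed
    then have "Obj (comma ?T SL f (object_functor SL (Ide C X))) =
        {(undefined, e (Ide C X, f))}"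
      by (auto simp: Obj_comma object_functor_def terminal_cat_def)
    then show "Obj (comma ?T SL f (object_functor SL (Ide C X))) \<noteq> {}"
      and "connected_category (comma ?T SL f (object_functor SL (Ide C X)))"
      by (simp_all add: connected_category_def)
  qed
qed

end

section \<open>The functor to a slice given by a split cocone\<close>

context diagram
begin

text \<open>A cocone with vertex \<open>X\<close> amounts to a lift of \<open>D\<close> to the slice
  over \<open>X\<close>.\<close>

definition cocone_functor :: "('a \<times> 'a \<Rightarrow> 'b) \<Rightarrow> ('i \<Rightarrow> 'a) \<Rightarrow> ('i, 'k, 'a, 'b) func" where
  "cocone_functor e \<iota> = \<lparr>FObj = \<iota>, FArr = (\<lambda>u. e (\<iota> (Cod J u), FArr D u))\<rparr>"

text \<open>For \<open>f\<close> with domain \<open>z\<close>, the comma category under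
  \<open>f\<close> is the full subcategory of \<open>z/D\<close> on the pairs \<open>(j, g)\<close>
  for which \<open>\<iota> j\<close> after \<open>g\<close> is \<open>f\<close>. It contains
  \<open>i\<close> with \<open>s\<close> after \<open>f\<close>. Precomposing the connection between
  \<open>s\<close> after \<open>\<iota> j\<close> and the identity with \<open>g\<close> joins this
  pair to \<open>(j, g)\<close>.\<close>

lemma confinal_cocone_functor:
  fixes e :: "'a \<times> 'a \<Rightarrow> 'b"
  assumes e: "inj e" and split: "split_cocone X \<iota> i s" and S: "FObj D ` Obj J \<subseteq> S"
  shows "confinal J (slice e C X S) (cocone_functor e \<iota>)"
    and "functor_eq J (functor_comp (slice_projection e C) (cocone_functor e \<iota>)) D"
proof -
  interpret slice_category C e X S
    using e by unfold_locales
  let ?G = "cocone_functor e \<iota>"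
  have cocone: "is_cocone J C D X \<iota>" and i: "i \<in> Obj J" and s: "s \<in> Hom C X (FObj D i)"
    and is_id: "Comp C (\<iota> i) s = Ide C X"
    and conn: "\<And>j. j \<in> Obj J \<Longrightarrow> conn (FObj D j) (i, Comp C s (\<iota> j)) (j, Ide C (FObj D j))"
    using split by (simp_all add: split_cocone_def)
  note \<iota> = cocone_Hom[OF cocone]
  have G_simps: "FObj ?G j = \<iota> j" "u \<in> Hom J k j \<Longrightarrow> FArr ?G u = e (\<iota> j, FArr D u)" for k j u
    by (simp_all add: cocone_functor_def Hom_Arr)
  have Dom_\<iota>: "Dom C (\<iota> j) = FObj D j" if "j \<in> Obj J" for j
    using Hom_Arr[OF \<iota>[OF that]] by simp
  have Gj: "\<iota> j \<in> Obj SL" if "j \<in> Obj J" for j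
    using \<iota>[OF that] S that by (auto simp: Obj_slice Dom_\<iota>)
  show "functor_eq J (functor_comp (slice_projection e C) ?G) D"
    unfolding functor_eq_def by (simp add: cocone_functor_def Dom_\<iota>)
  have G: "is_functor J SL ?G"
  proof (rule is_functorI)
    show "FArr ?G u \<in> Hom SL (FObj ?G j) (FObj ?G k)" if u: "u \<in> Hom J j k" for j k u
      using Hom_sliceI[OF Gj Gj, of j k "FArr D u"] functor_Hom[OF D u] cocone_Comp[OF cocone u]
        J.Hom_Obj[OF u] by (simp add: G_simps(1) G_simps(2)[OF u] Dom_\<iota>)
    show "FArr ?G (Ide J j) = Ide SL (FObj ?G j)" if j: "j \<in> Obj J" for j
      by (simp add: G_simps(1) G_simps(2)[OF J.Ide_Hom[OF j]] functor_Ide[OF D j] Dom_\<iota>[OF j])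
    show "FArr ?G (Comp J v u) = Comp SL (FArr ?G v) (FArr ?G u)"
      if u: "u \<in> Hom J j k" and v: "v \<in> Hom J k l" for j k l u v
      by (simp add: G_simps(2)[OF u] G_simps(2)[OF v] G_simps(2)[OF J.Comp_Hom[OF u v]]
          functor_Comp[OF D u v])
  qed (simp add: G_simps(1) Gj)
  show "confinal J SL ?G"
    unfolding confinal_def connected_category_def
  proof (intro conjI ballI)
    fix f assume f: "f \<in> Obj SL"
    then have f': "f \<in> Hom C (Dom C f) X" by (simp add: Obj_slice)
    let ?K = "comma J SL f ?G" and ?E = "elements (Dom C f)"
    let ?R = "equivclp (\<lambda>p q. Hom ?K p q \<noteq> {})"
    \<comment> \<open>An element \<open>(j, g)\<close> of \<open>z/D\<close> with \<open>g\<close>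
      coded as an arrow of the slice into \<open>\<iota> j\<close>.\<close>
    let ?T = "\<lambda>p. (fst p, e (\<iota> (fst p), snd p))"
    have K_iff: "?T p \<in> Obj ?K \<longleftrightarrow> p \<in> ?E \<and> Comp C (\<iota> (fst p)) (snd p) = f" for p
    proof
      assume "?T p \<in> Obj ?K"
      then have j: "fst p \<in> Obj J" and "e (\<iota> (fst p), snd p) \<in> Hom SL f (\<iota> (fst p))"
        by (auto simp: Obj_comma G_simps(1))
      then show "p \<in> ?E \<and> Comp C (\<iota> (fst p)) (snd p) = f"
        using inj_eq[OF e] Dom_\<iota>[OF j]
        by (elim Hom_sliceE) (auto simp: Obj_comma)
    next
      assume p: "p \<in> ?E \<and> Comp C (\<iota> (fst p)) (snd p) = f"
      then have j: "fst p \<in> Obj J" and "snd p \<in> Hom C (Dom C f) (FObj D (fst p))"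
        by (auto simp: Obj_comma)
      then show "?T p \<in> Obj ?K"
        using Hom_sliceI[OF f Gj[OF j]] p by (simp add: Obj_comma G_simps(1) Dom_\<iota>)
    qed
    let ?b = "(i, Comp C s f)"
    have sf: "Comp C s f \<in> Hom C (Dom C f) (FObj D i)" using C.Comp_Hom[OF f' s] .
    have "Comp C (\<iota> i) (Comp C s f) = f"
      using C.Comp_assoc[OF f' s \<iota>[OF i]] is_id C.Comp_Ide_left[OF f'] by simp
    then have b: "?T ?b \<in> Obj ?K" using i sf K_iff[of ?b] by (simp add: elements_iff)
    then show "Obj ?K \<noteq> {}" by blast
    have to_base: "?R (?T ?b) x" if x: "x \<in> Obj ?K" for x
    proof -
      obtain j a where xj: "x = (j, a)" "j \<in> Obj J" "a \<in> Hom SL f (\<iota> j)"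
        using x by (auto simp: Obj_comma G_simps(1))
      obtain g where a: "a = e (\<iota> j, g)" and "g \<in> Hom C (Dom C f) (Dom C (\<iota> j))"
        and gf: "Comp C (\<iota> j) g = f" using xj(3) by (rule Hom_sliceE)
      then have g: "g \<in> Hom C (Dom C f) (FObj D j)" using Dom_\<iota>[OF xj(2)] by simp
      have "conn (Dom C f) (i, Comp C (Comp C s (\<iota> j)) g) (j, Comp C (Ide C (FObj D j)) g)"
        using conn_precompose[OF conn[OF xj(2)] g] by simp
      then have path: "conn (Dom C f) ?b (j, g)"
        using C.Comp_assoc[OF g \<iota>[OF xj(2)] s] gf C.Comp_Ide_left[OF g] by simp
      \<comment> \<open>The path found above lives in the larger category \<open>z/D\<close>. The
        induction shows that it never leaves the subcategory.\<close>
      have "?T q \<in> Obj ?K \<and> ?R (?T ?b) (?T q)" if "conn (Dom C f) ?b q" for q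
        using that
      proof (induction rule: equivclp_induct)
        case base
        then show ?case using b by simp
      next
        case (step p q)
        \<comment> \<open>Membership is an equivalence here because a step of the path may run
          against its arrow.\<close>
        have *: "(?T p \<in> Obj ?K \<longleftrightarrow> ?T q \<in> Obj ?K) \<and> (?T p \<in> Obj ?K \<longrightarrow> ?R (?T p) (?T q))"
          if pq: "Hom (comma J C (Dom C f) D) p q \<noteq> {}" for p q
        proof -
          obtain u where u: "u \<in> Hom J (fst p) (fst q)" "Comp C (FArr D u) (snd p) = snd q"
            and p: "p \<in> ?E" and q: "q \<in> ?E"
            using pq unfolding Hom_comma_iff by auto
          have "fst q \<in> Obj J" "snd p \<in> Hom C (Dom C f) (FObj D (fst p))"
            using p q by (auto simp: Obj_comma)
          then have "Comp C (\<iota> (fst q)) (snd q) = Comp C (\<iota> (fst p)) (snd p)"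
            using C.Comp_assoc[OF _ functor_Hom[OF D u(1)] \<iota>] cocone_Comp[OF cocone u(1)] u(2)
            by metis
          then have iff: "?T p \<in> Obj ?K \<longleftrightarrow> ?T q \<in> Obj ?K"
            using p q K_iff[of p] K_iff[of q] by simp
          have "Hom ?K (?T p) (?T q) \<noteq> {}" if "?T p \<in> Obj ?K"
            using that iff u G_simps(2)[OF u(1)] unfolding Hom_comma_iff
            by (auto intro!: bexI[OF _ u(1)])
          then show ?thesis using iff by blast
        qed
        then show ?case
          using step.hyps(2) step.IH *[of p q] *[of q p]
          by (meson equivclp_sym equivclp_trans)
      qed
      then show ?thesis using path by (force simp: xj(1) a)
    qed
    show "?R x y" if "x \<in> Obj ?K" "y \<in> Obj ?K" for x y
      using to_base[OF that(1)] to_base[OF that(2)] by (rule equivclp_trans[OF equivclp_sym])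
  qed (rule G)
qed

end

section \<open>Smallness\<close>

lemma infinite_pairing:
  assumes "infinite (UNIV :: 'v set)"
  obtains e :: "'v \<times> 'v \<Rightarrow> 'v" where "inj e"
proof -
  from card_of_Times_same_infinite[OF assms, THEN ordIso_imp_ordLeq]
  obtain e :: "'v \<times> 'v \<Rightarrow> 'v" where "inj_on e (UNIV \<times> UNIV)"
    unfolding card_of_ordLeq[symmetric] by blast
  then show thesis using that by simp
qed

context smallness
begin

text \<open>A binary union is obtained from \<open>UNION_small\<close> with a two-element index set,
  for which the universe supplies a second element \<open>y\<close>.\<close>

lemma insert_small:
  assumes "small A"
  shows "small (insert x A)"
proof -
  obtain y where "y \<noteq> x"
    using ex_new_if_finite[OF infinite_universe, of "{x}"] by auto
  then have "insert x A = (\<Union>z\<in>{x, y}. if z = x then {x} else A)" by auto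
  moreover have "small \<dots>"
    using assms by (intro UNION_small) (auto simp: finite_small)
  ultimately show ?thesis by simp
qed

lemma collage_codings:
  obtains p :: "'v option \<Rightarrow> 'v" and q :: "('v, 'v) collage_arr \<Rightarrow> 'v" where "inj p" "inj q"
proof -
  obtain e :: "'v \<times> 'v \<Rightarrow> 'v" where e: "inj e" using infinite_pairing[OF infinite_universe] .
  obtain a b c :: 'v where abc: "a \<noteq> b" "a \<noteq> c" "b \<noteq> c"
  proof -
    obtain b :: 'v where "b \<notin> {undefined}"
      using ex_new_if_finite[OF infinite_universe, of "{undefined}"] by auto
    moreover obtain c :: 'v where "c \<notin> {undefined, b}"
      using ex_new_if_finite[OF infinite_universe, of "{undefined, b}"] by auto
    ultimately show thesis using that by auto
  qed
  \<comment> \<open>The first component of the outer pair is a tag that tells the constructors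
    apart.\<close>
  have "inj (\<lambda>x. case x of None \<Rightarrow> e (a, a) | Some x \<Rightarrow> e (b, x))"
    using abc by (auto simp: inj_on_def inj_eq[OF e] split: option.splits)
  moreover have "inj (\<lambda>f. case f of Base f \<Rightarrow> e (a, f) | Elem s \<Rightarrow> e (b, e s) | Apex \<Rightarrow> e (c, c))"
    using abc by (auto simp: inj_on_def inj_eq[OF e] split: collage_arr.splits)
  ultimately show thesis using that by blast
qed

lemma locally_small_collage:
  fixes J C :: "('v, 'v) cat" and p :: "'v option \<Rightarrow> 'v" and q :: "('v, 'v) collage_arr \<Rightarrow> 'v"
  assumes "diagram J C D" and C: "locally_small small C" and J: "small_category small J"
    and p: "inj p" and q: "inj q"
  shows "locally_small small (relabel p q (diagram.collage J C D))"
proof -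
  interpret diagram J C D by fact
  interpret relabelling collage p q
    using category_collage p q by (simp add: relabelling_def relabelling_axioms_def)
  have sm: "small (Hom C x y)" if "x \<in> Obj C" "y \<in> Obj C" for x y
    using C that by (simp add: locally_small_def)
  have "small (q ` Hom collage a b)" if ab: "a \<in> Obj collage" "b \<in> Obj collage" for a b
  proof (cases a)
    case None
    then have "finite (Hom collage a b)" by (cases b) (simp_all add: Hom_collage)
    then show ?thesis by (simp add: finite_small)
  next
    case (Some x)
    then have x: "x \<in> Obj C" using ab by auto
    show ?thesis
    proof (cases b)
      case None
      \<comment> \<open>The objects of \<open>x/D\<close> form a small union of hom-sets, and the
        arrows to the adjoined object are an image of it, so power sets do not enter.\<close>
      have "elements x = (\<Union>j\<in>Obj J. Pair j ` Hom C x (FObj D j))"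
        by (auto simp: elements_iff)
      then have "q ` Hom collage a b =
          (\<Union>j\<in>Obj J. (\<lambda>f. q (Elem (canon x (j, f)))) ` Hom C x (FObj D j))"
        using Some None x by (simp add: Hom_collage image_UN image_image)
      also have "small \<dots>"
        using J sm[OF x functor_Obj[OF D]]
        by (intro UNION_small image_small) (simp_all add: small_category_def)
      finally show ?thesis .
    next
      case b: (Some y)
      then show ?thesis
        using sm[of x y] x Some ab image_small[of "Hom C x y" "q \<circ> Base"]
        by (auto simp: Hom_collage image_comp)
    qed
  qed
  then show ?thesis
    using category_relabel by (auto simp: locally_small_def Hom_relabel)
qed

text \<open>The whole slice may have a proper class of objects. Over a small \<open>S\<close> they
  form a small union of hom-sets, and arrows are coded by an object and an arrow between members of
  \<open>S\<close>.\<close>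

lemma small_category_slice:
  fixes C :: "('v, 'v) cat" and e :: "'v \<times> 'v \<Rightarrow> 'v"
  assumes C: "locally_small small C" and e: "inj e" and S: "small S" "S \<subseteq> Obj C"
    and X: "X \<in> Obj C"
  shows "small_category small (slice e C X S)"
proof -
  interpret category C using C by (simp add: locally_small_def)
  interpret slice_category C e X S using e by unfold_locales
  have sm: "small (Hom C x y)" if "x \<in> Obj C" "y \<in> Obj C" for x y
    using C that by (simp add: locally_small_def)
  have "Obj SL \<subseteq> (\<Union>x\<in>S. Hom C x X)"
    by (auto simp: Obj_slice)
  moreover have "small (\<Union>x\<in>S. Hom C x X)"
    using S X sm by (intro UNION_small) auto
  ultimately have O: "small (Obj SL)" by (rule subset_small[rotated])
  let ?U = "\<Union>x\<in>S. \<Union>y\<in>S. Hom C x y"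
  have "small ?U" using S sm by (intro UNION_small) auto
  then have "small (\<Union>g\<in>Obj SL. (\<lambda>u. e (g, u)) ` ?U)"
    by (intro UNION_small[OF O] image_small)
  moreover have "Arr SL \<subseteq> (\<Union>g\<in>Obj SL. (\<lambda>u. e (g, u)) ` ?U)"
    by (auto simp: slice_def Hom_def)
  ultimately have "small (Arr SL)" by (rule subset_small)
  then show ?thesis using O category_slice by (simp add: small_category_def)
qed

end

text \<open>The zigzag consists of two arrows into a common slice: \<open>\<iota>\<close> from
  \<open>J\<close> and the identity of \<open>X\<close> from the terminal category.\<close>

lemma confinal_zigzag_if_split_cocone:
  fixes J C :: "('v, 'v) cat"
  assumes "smallness small" and "locally_small small C" and "small_category small J"
    and D: "is_functor J C D" and X: "X \<in> Obj C"
    and split: "diagram.split_cocone J C D X \<iota> i s"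
  shows "confinal_zigzag small C (J, D) (terminal_cat, object_functor C X)"
proof -
  interpret smallness small by fact
  interpret diagram J C D
    using D \<open>locally_small small C\<close> \<open>small_category small J\<close>
    by (simp add: diagram_def diagram_axioms_def locally_small_def small_category_def)
  obtain e :: "'v \<times> 'v \<Rightarrow> 'v" where e: "inj e" using infinite_pairing[OF infinite_universe] .
  \<comment> \<open>The values of \<open>D\<close> are needed for the first arrow of the zigzag and
    \<open>X\<close> for the second.\<close>
  let ?S = "insert X (FObj D ` Obj J)"
  interpret slice_category C e X ?S using e by unfold_locales
  have "small ?S"
    using \<open>small_category small J\<close>
    by (intro insert_small image_small) (simp add: small_category_def)
  then have SL: "small_category small SL"
    using functor_Obj[OF D] X by (intro small_category_slice[OF \<open>locally_small small C\<close> e]) auto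
  let ?r = "\<lambda>\<S> \<T>. \<exists>G. Cat_over_arr small C \<S> \<T> G \<and> confinal (fst \<S>) (fst \<T>) G"
  let ?P = "(SL, slice_projection e C)"
  have JP: "?r (J, D) ?P"
    using confinal_cocone_functor[OF e split, of ?S] SL slice_projection_is_functor D
      \<open>small_category small J\<close>
    by (intro exI[of _ "cocone_functor e \<iota>"])
      (auto simp: Cat_over_arr_def Cat_over_obj_def confinal_def)
  have XP: "?r (terminal_cat, object_functor C X) ?P"
    using confinal_terminal_slice[OF X] SL slice_projection_is_functor
      is_functor_terminal[OF C.category_axioms X] small_category_terminal[OF \<open>smallness small\<close>]
    by (intro exI[of _ "object_functor SL (Ide C X)"])
      (auto simp: Cat_over_arr_def Cat_over_obj_def confinal_def)
  show ?thesis
    unfolding confinal_zigzag_def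
    by (rule equivclp_trans[OF r_into_equivclp[of ?r, OF JP]
          equivclp_sym[OF r_into_equivclp[of ?r, OF XP]]])
qed

theorem proposition3p13:
  fixes small :: "'v set \<Rightarrow> bool"
    and C :: "('v, 'v) cat"
    and J :: "('v, 'v) cat"
    and D :: "('v, 'v, 'v, 'v) func"
    and X :: 'v
  assumes "smallness small"
    and "locally_small small C"
    and "small_category small J"
    and "is_functor J C D"
    and "X \<in> Obj C"
  shows "(absolute_colimit small C J D X \<longleftrightarrow>
          (\<forall>(E :: ('v, 'v) cat) (F :: ('v, 'v, 'v, 'v) func).
             locally_small small E \<and> is_functor C E F \<longrightarrow>
             is_colimit J E (functor_comp F D) (FObj F X)))
       \<and> (absolute_colimit small C J D X \<longleftrightarrow>
          confinal_zigzag small C (J, D) (terminal_cat, object_functor C X))"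
    (is "(?one \<longleftrightarrow> ?two) \<and> (?one \<longleftrightarrow> ?three)")
proof -
  note C = \<open>locally_small small C\<close> and D = \<open>is_functor J C D\<close> and X = \<open>X \<in> Obj C\<close>
  interpret smallness small by fact
  interpret diagram J C D
    using C D \<open>small_category small J\<close>
    by (simp add: diagram_def diagram_axioms_def locally_small_def small_category_def)
  note one_iff = absolute_colimit_iff[OF C J.category_axioms D X]
  have "?one \<Longrightarrow> ?two"
  proof (intro allI impI, elim conjE)
    fix E :: "('v, 'v) cat" and F :: "('v, 'v, 'v, 'v) func"
    assume ?one and E: "locally_small small E" and F: "is_functor C E F"
    interpret nerve_setting small C E F
      using C E F by (simp add: nerve_setting_def nerve_setting_axioms_def locally_small_def)
    show "is_colimit J E (functor_comp F D) (FObj F X)"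
      using is_colimit_of_representables[OF J.category_axioms D X] \<open>?one\<close> one_iff by simp
  qed
  moreover have "?two \<Longrightarrow> ?three"
  proof -
    assume two: ?two
    obtain p :: "'v option \<Rightarrow> 'v" and q :: "('v, 'v) collage_arr \<Rightarrow> 'v" where p: "inj p" and q: "inj q"
      using collage_codings .
    interpret R: relabelling collage p q
      using category_collage p q by (simp add: relabelling_def relabelling_axioms_def)
    let ?F = "functor_comp R.relabel_functor collage_inclusion"
    have "is_functor C (relabel p q collage) ?F"
      by (rule functor_comp_is_functor[OF collage_inclusion_is_functor R.relabel_functor_is_functor])
    then have "is_colimit J (relabel p q collage) (functor_comp ?F D) (FObj ?F X)"
      using two locally_small_collage[OF diagram_axioms C \<open>small_category small J\<close> p q] by blast
    \<comment> \<open>Reassociated so that the relabelling comes last, as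
      \<open>is_colimit_relabel\<close> expects.\<close>
    then have "is_colimit J (relabel p q collage)
        (functor_comp R.relabel_functor (functor_comp collage_inclusion D)) (p (Some X))"
      by (simp add: functor_comp_def comp_assoc)
    then have "is_colimit J collage (functor_comp collage_inclusion D) (Some X)"
      using X by (intro R.is_colimit_relabel[OF J.category_axioms
            functor_comp_is_functor[OF D collage_inclusion_is_functor]]) auto
    then obtain \<iota> i s where split: "split_cocone X \<iota> i s"
      by (rule split_cocone_if_colimit[OF X])
    show ?three
      by (rule confinal_zigzag_if_split_cocone[OF assms split])
  qed
  moreover have "?three \<Longrightarrow> ?one"
  proof -
    assume three: ?three
    interpret nerve_setting small C C id_functor
      using C by (simp add: nerve_setting_def nerve_setting_axioms_def locally_small_def
          id_functor_is_functor)
    let ?P = "presheaf_category small C"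
    have P: "category ?P" by (rule category_presheaf_category[OF C.category_axioms])
    \<comment> \<open>The representable on \<open>X\<close> is the image presheaf of the end
      \<open>X\<close> of the zigzag; invariance along the zigzag carries this over to
      \<open>D\<close>.\<close>
    have "is_colimit terminal_cat ?P (functor_comp (yoneda C) (object_functor C X)) (representable C X)"
      using is_colimit_terminal[OF P yoneda_is_functor X] by (simp add: yoneda_FObj)
    then show ?one
      using is_colimit_confinal_zigzag[OF P yoneda_is_functor three] one_iff by simp
  qed
  ultimately show ?thesis by blast
qed

end
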